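(* The equational theory of the time warp algebra $\mathbf{W}$ is decidable: there is an algorithm that, given any two terms $s,t$, decides whether $\mathbf{W}\models s\approx t$.
   Context: Let $\omega^+=\omega\cup\{\omega\}$ with its natural order. A time warp is a map $f\colon\omega^+\to\omega^+$ preserving arbitrary joins (equivalently, $f$ is order-preserving, $f(0)=0$ and $f(\omega)=\bigvee\{f(n)\mid n\in\omega\}$). Let $W$ be the set of time warps, ordered pointwise. Let $p\in W$ be the predecessor map $p(m)=\bigvee\{n\in\omega\mid n<m\}$ (so $p(0)=0$, $p(\omega)=\omega$, $p(m)=m-1$ otherwise), and for $f,g\in W$ let $f\backslash g$ be the largest time warp $h$ with $f\circ h\le g$. The time warp algebra is $\mathbf{W}=\langle W,\wedge,\vee,\circ,{}^\star,\mathrm{id}\rangle$ with pointwise meet and join, composition, involution $f^\star:=f\backslash p$, and identity $\mathrm{id}$. Terms are built from a countably infinite set of variables using binary $\wedge,\vee,\cdot$, unary ${}'$ and the constant $1$, interpreted in $\mathbf{W}$ as $\wedge,\vee,\circ,{}^\star,\mathrm{id}$; $\mathbf{W}\models s\approx t$ means that $s$ and $t$ take equal values under every assignment of time warps to variables. *)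

theory Defs
  imports Main "HOL-Library.Extended_Nat" "HOL-Library.Nat_Bijection"
begin

text \<open>omega^+ is modelled by enat (natural numbers plus infinity, with its natural
  complete-lattice order). Time warps are maps preserving arbitrary joins.\<close>

definition time_warps :: "(enat \<Rightarrow> enat) set" where
  "time_warps = {f. \<forall>A. f (Sup A) = Sup (f ` A)}"

definition tw_pred :: "enat \<Rightarrow> enat" where
  "tw_pred m = Sup {enat n | n. enat n < m}"

definition tw_resid :: "(enat \<Rightarrow> enat) \<Rightarrow> (enat \<Rightarrow> enat) \<Rightarrow> (enat \<Rightarrow> enat)" where
  "tw_resid f g = (GREATEST h. h \<in> time_warps \<and> f \<circ> h \<le> g)"

definition tw_star :: "(enat \<Rightarrow> enat) \<Rightarrow> (enat \<Rightarrow> enat)" where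
  "tw_star f = tw_resid f tw_pred"

datatype trm = Var nat | Meet trm trm | Join trm trm | Dot trm trm | Inv trm | One

primrec tw_eval :: "(nat \<Rightarrow> (enat \<Rightarrow> enat)) \<Rightarrow> trm \<Rightarrow> (enat \<Rightarrow> enat)" where
  "tw_eval \<sigma> (Var i) = \<sigma> i"
| "tw_eval \<sigma> (Meet s t) = inf (tw_eval \<sigma> s) (tw_eval \<sigma> t)"
| "tw_eval \<sigma> (Join s t) = sup (tw_eval \<sigma> s) (tw_eval \<sigma> t)"
| "tw_eval \<sigma> (Dot s t) = tw_eval \<sigma> s \<circ> tw_eval \<sigma> t"
| "tw_eval \<sigma> (Inv s) = tw_star (tw_eval \<sigma> s)"
| "tw_eval \<sigma> One = id"

definition W_models :: "trm \<Rightarrow> trm \<Rightarrow> bool" where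
  "W_models s t \<longleftrightarrow> (\<forall>\<sigma>. (\<forall>i. \<sigma> i \<in> time_warps) \<longrightarrow> tw_eval \<sigma> s = tw_eval \<sigma> t)"

primrec trm_code :: "trm \<Rightarrow> nat" where
  "trm_code (Var i) = prod_encode (0, i)"
| "trm_code One = prod_encode (1, 0)"
| "trm_code (Inv s) = prod_encode (2, trm_code s)"
| "trm_code (Meet s t) = prod_encode (3, prod_encode (trm_code s, trm_code t))"
| "trm_code (Join s t) = prod_encode (4, prod_encode (trm_code s, trm_code t))"
| "trm_code (Dot s t) = prod_encode (5, prod_encode (trm_code s, trm_code t))"

datatype recf = Zf | Sf | Proj nat | Cn recf "recf list" | Pr recf recf | Mn recf

inductive rec_eval :: "recf \<Rightarrow> nat list \<Rightarrow> nat \<Rightarrow> bool" where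
  "rec_eval Zf xs 0"
| "rec_eval Sf (x # xs) (Suc x)"
| "i < length xs \<Longrightarrow> rec_eval (Proj i) xs (xs ! i)"
| "list_all2 (\<lambda>g y. rec_eval g xs y) gs ys \<Longrightarrow> rec_eval f ys z \<Longrightarrow> rec_eval (Cn f gs) xs z"
| "rec_eval f xs y \<Longrightarrow> rec_eval (Pr f g) (0 # xs) y"
| "rec_eval (Pr f g) (n # xs) y \<Longrightarrow> rec_eval g (n # y # xs) z \<Longrightarrow> rec_eval (Pr f g) (Suc n # xs) z"
| "rec_eval f (n # xs) 0 \<Longrightarrow> (\<forall>m<n. \<exists>y. rec_eval f (m # xs) y \<and> y \<noteq> 0) \<Longrightarrow> rec_eval (Mn f) xs n"

end

theory Submission
  imports Defs
begin

text \<open>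
  For a time warp \<open>f\<close> one has \<open>f\<^sup>\<star> x = Sup {y. f y < x}\<close>. Hence \<open>f\<^sup>\<star> x = y\<close> with \<open>x > 0\<close> and \<open>y\<close>
  finite says \<open>f y < x \<le> f (y + 1)\<close>, and \<open>f\<^sup>\<star> x = \<infinity>\<close> with \<open>x > 0\<close> finite says \<open>f \<infinity> < x\<close>; so
  the value of a term at a point is determined by finitely many values of its variables, except that
  \<open>f\<^sup>\<star> \<infinity> = \<infinity>\<close> says that \<open>f\<close> maps finite numbers to finite numbers. This last property in turn
  reduces, through all term constructors, to the same property of subterms and to their values at
  points already considered. A failing equation is therefore witnessed by finitely many facts
  ``\<open>u\<close> maps \<open>x\<close> to \<open>y\<close>'' and ``\<open>u\<close> preserves finiteness'', each justified by facts about immediate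
  subterms through conditions that mention only the order, zero, successor of occurring points, and
  infinity. Replacing every occurring number by its rank among the occurring numbers preserves these
  conditions and bounds all numbers by a computable function of the two terms; conversely, any
  consistent set of facts about the variables extends to time warps. Validity is thus the absence of
  a witness in a computable finite range.
\<close>

section \<open>Computable functions\<close>

text \<open>Arguments are passed as an environment, so that \<open>e i\<close> is the \<open>i\<close>-th argument and the variable
  bound by a quantifier becomes \<open>e 0\<close>, which shifts the other arguments.\<close>

definition computable :: "nat \<Rightarrow> ((nat \<Rightarrow> nat) \<Rightarrow> nat) \<Rightarrow> bool" where
  "computable n f \<longleftrightarrow> (\<exists>r. \<forall>e. rec_eval r (map e [0..<n]) (f e))"

definition decidable :: "nat \<Rightarrow> ((nat \<Rightarrow> nat) \<Rightarrow> bool) \<Rightarrow> bool" where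
  "decidable n P \<longleftrightarrow> computable n (\<lambda>e. if P e then 1 else 0)"

lemma computable_proj: "i < n \<Longrightarrow> computable n (\<lambda>e. e i)"
  unfolding computable_def
proof (intro exI allI)
  fix e :: "nat \<Rightarrow> nat" assume "i < n"
  then show "rec_eval (Proj i) (map e [0..<n]) (e i)"
    using rec_eval.intros(3)[of i "map e [0..<n]"] by simp
qed

text \<open>Taking projections for \<open>gs\<close> gives permutation, omission and repetition of
  arguments, which the proofs about recursion and quantifiers below rely on.\<close>

lemma computable_compose:
  assumes f: "computable m f" and gs: "\<And>i. i < m \<Longrightarrow> computable n (gs i)"
  shows "computable n (\<lambda>e. f (\<lambda>i. gs i e))"
proof -
  obtain r where r: "\<And>e. rec_eval r (map e [0..<m]) (f e)"
    using f unfolding computable_def by blast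
  have "\<forall>i. \<exists>q. i < m \<longrightarrow> (\<forall>e. rec_eval q (map e [0..<n]) (gs i e))"
    using gs unfolding computable_def by blast
  then obtain q where q: "\<And>i e. i < m \<Longrightarrow> rec_eval (q i) (map e [0..<n]) (gs i e)"
    by metis
  have "rec_eval (Cn r (map q [0..<m])) (map e [0..<n]) (f (\<lambda>i. gs i e))" for e
  proof (rule rec_eval.intros(4)[OF _ r])
    show "list_all2 (\<lambda>g y. rec_eval g (map e [0..<n]) y) (map q [0..<m]) (map (\<lambda>i. gs i e) [0..<m])"
      using q by (simp add: list_all2_conv_all_nth)
  qed
  then show ?thesis unfolding computable_def by blast
qed

lemma computable_Suc: "computable n f \<Longrightarrow> computable n (\<lambda>e. Suc (f e))"
proof -
  assume f: "computable n f"
  have "computable 1 (\<lambda>e. Suc (e 0))"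
    unfolding computable_def using rec_eval.intros(2)[of _ "[]"] by auto
  from computable_compose[OF this, of n "\<lambda>_. f"] f show ?thesis by simp
qed

lemma computable_const: "computable n (\<lambda>e. c)"
proof (induction c)
  case 0
  show ?case unfolding computable_def using rec_eval.intros(1) by blast
next
  case (Suc c)
  then show ?case by (rule computable_Suc)
qed

lemma computable_comp1:
  assumes "computable 1 (\<lambda>e. h (e 0))" "computable n f"
  shows "computable n (\<lambda>e. h (f e))"
  using computable_compose[OF assms(1), of n "\<lambda>_. f"] assms(2) by simp

lemma computable_comp2:
  assumes "computable 2 (\<lambda>e. h (e 0) (e 1))" "computable n f" "computable n g"
  shows "computable n (\<lambda>e. h (f e) (g e))"
  using computable_compose[OF assms(1), of n "\<lambda>i. if i = 0 then f else g"] assms(2,3) by simp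

text \<open>\<open>Pr\<close> passes the counter, then the previous value, then the parameters;
  hence \<open>g\<close> reads \<open>e 0\<close>, \<open>e (Suc 0)\<close> and the environment
  shifted by two.\<close>

lemma computable_rec:
  assumes b: "computable n b" and f: "computable n f"
    and g: "computable (Suc (Suc n)) (\<lambda>e. g (e 0) (e (Suc 0)) (\<lambda>i. e (Suc (Suc i))))"
  shows "computable n (\<lambda>e. rec_nat (f e) (\<lambda>k y. g k y e) (b e))"
proof -
  obtain rf where rf: "\<And>e. rec_eval rf (map e [0..<n]) (f e)"
    using f unfolding computable_def by blast
  obtain rg where rg: "\<And>e. rec_eval rg (map e [0..<Suc (Suc n)])
      (g (e 0) (e (Suc 0)) (\<lambda>i. e (Suc (Suc i))))"
    using g unfolding computable_def by blast
  have rg': "rec_eval rg (k # y # map e [0..<n]) (g k y e)" for k y e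
  proof -
    have "map (case_nat k (case_nat y e)) [0..<Suc (Suc n)] = k # y # map e [0..<n]"
      by (simp add: map_upt_Suc del: upt_Suc)
    then show ?thesis using rg[of "case_nat k (case_nat y e)"] by simp
  qed
  have pr: "rec_eval (Pr rf rg) (k # map e [0..<n]) (rec_nat (f e) (\<lambda>k y. g k y e) k)" for k e
    by (induction k) (auto intro: rec_eval.intros rf rg')
  have "computable (Suc n) (\<lambda>e. rec_nat (f (\<lambda>i. e (Suc i))) (\<lambda>k y. g k y (\<lambda>i. e (Suc i))) (e 0))"
    unfolding computable_def
  proof (intro exI allI)
    fix e :: "nat \<Rightarrow> nat"
    have "map e [0..<Suc n] = e 0 # map (\<lambda>i. e (Suc i)) [0..<n]"
      by (rule map_upt_Suc)
    then show "rec_eval (Pr rf rg) (map e [0..<Suc n])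
        (rec_nat (f (\<lambda>i. e (Suc i))) (\<lambda>k y. g k y (\<lambda>i. e (Suc i))) (e 0))"
      using pr[of "e 0" "\<lambda>i. e (Suc i)"] by simp
  qed
  \<comment> \<open>Slot 0, the number of rounds, is filled by \<open>b\<close>, and slot
    \<open>Suc i\<close> by argument \<open>i\<close>, which undoes the shift.\<close>
  from computable_compose[OF this, of n "case_nat b (\<lambda>i e. e i)"]
  show ?thesis using b by (simp add: computable_proj split: nat.split)
qed

lemma computable_add:
  assumes "computable n f" "computable n g" shows "computable n (\<lambda>e. f e + g e)"
proof -
  have eq: "x + y = rec_nat x (\<lambda>k. Suc) y" for x y by (induction y) auto
  have "computable 2 (\<lambda>e. rec_nat (e 0) (\<lambda>k. Suc) (e 1))"
    by (intro computable_rec computable_Suc computable_proj) simp_all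
  then show ?thesis unfolding eq by (rule computable_comp2) fact+
qed

lemma computable_mult:
  assumes "computable n f" "computable n g" shows "computable n (\<lambda>e. f e * g e)"
proof -
  have eq: "x * y = rec_nat 0 (\<lambda>k z. z + x) y" for x y :: nat by (induction y) auto
  have "computable 2 (\<lambda>e. rec_nat 0 (\<lambda>k z. z + e 0) (e 1))"
    by (intro computable_rec computable_add computable_const computable_proj) simp_all
  then show ?thesis unfolding eq by (rule computable_comp2) fact+
qed

lemma computable_power:
  assumes "computable n f" "computable n g" shows "computable n (\<lambda>e. f e ^ g e)"
proof -
  have eq: "x ^ y = rec_nat 1 (\<lambda>k z. z * x) y" for x y :: nat by (induction y) auto
  have "computable 2 (\<lambda>e. rec_nat 1 (\<lambda>k z. z * e 0) (e 1))"
    by (intro computable_rec computable_mult computable_const computable_proj) simp_all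
  then show ?thesis unfolding eq by (rule computable_comp2) fact+
qed

lemma computable_diff:
  assumes "computable n f" "computable n g" shows "computable n (\<lambda>e. f e - g e)"
proof -
  have eq1: "x - Suc 0 = rec_nat 0 (\<lambda>k z. k) x" for x by (cases x) auto
  have 1: "computable 1 (\<lambda>e. e 0 - Suc 0)" unfolding eq1
    by (intro computable_rec computable_const computable_proj) simp_all
  have eq: "x - y = rec_nat x (\<lambda>k z. z - Suc 0) y" for x y :: nat by (induction y) auto
  have "computable 2 (\<lambda>e. rec_nat (e 0) (\<lambda>k z. z - Suc 0) (e 1))"
    by (intro computable_rec computable_comp1[OF 1] computable_proj) simp_all
  \<comment> \<open>The equation is read from right to left, since its right-hand side contains a
    difference again.\<close>
  then show ?thesis unfolding eq[symmetric] by (rule computable_comp2) fact+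
qed

lemma computable_prod_encode:
  assumes "computable n f" "computable n g" shows "computable n (\<lambda>e. prod_encode (f e, g e))"
proof -
  have eq: "triangle x = rec_nat 0 (\<lambda>k z. z + Suc k) x" for x by (induction x) auto
  have "computable 1 (\<lambda>e. triangle (e 0))" unfolding eq
    by (intro computable_rec computable_add computable_Suc computable_const computable_proj) simp_all
  then have "computable n (\<lambda>e. triangle (f e + g e))"
    by (rule computable_comp1) (intro computable_add assms)
  then show ?thesis unfolding prod_encode_def prod.case by (intro computable_add assms)
qed

section \<open>Connectives, comparisons and bounded quantifiers\<close>

lemma decidable_not: "decidable n P \<Longrightarrow> decidable n (\<lambda>e. \<not> P e)"
proof -
  assume P: "decidable n P"
  have "(\<lambda>e. if \<not> P e then 1 else 0) = (\<lambda>e. 1 - (if P e then 1 else 0 :: nat))" by auto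
  then show ?thesis using P unfolding decidable_def
    by (simp only:) (intro computable_diff computable_const)
qed

lemma decidable_conj:
  assumes "decidable n P" "decidable n Q" shows "decidable n (\<lambda>e. P e \<and> Q e)"
proof -
  have "(\<lambda>e. if P e \<and> Q e then 1 else 0) =
      (\<lambda>e. (if P e then 1 else 0) * (if Q e then 1 else 0 :: nat))" by auto
  then show ?thesis using assms unfolding decidable_def
    by (simp only:) (intro computable_mult)
qed

lemma decidable_disj:
  assumes "decidable n P" "decidable n Q" shows "decidable n (\<lambda>e. P e \<or> Q e)"
  using decidable_not[OF decidable_conj[OF decidable_not[OF assms(1)] decidable_not[OF assms(2)]]]
  by simp

lemma decidable_imp:
  assumes "decidable n P" "decidable n Q" shows "decidable n (\<lambda>e. P e \<longrightarrow> Q e)"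
  using decidable_disj[OF decidable_not[OF assms(1)] assms(2)] unfolding imp_conv_disj .

lemma decidable_le:
  assumes "computable n f" "computable n g" shows "decidable n (\<lambda>e. f e \<le> g e)"
proof -
  have "(\<lambda>e. if f e \<le> g e then 1 else 0) = (\<lambda>e. 1 - (f e - g e) :: nat)" by auto
  then show ?thesis using assms unfolding decidable_def
    by (simp only:) (intro computable_diff computable_const)
qed

lemma decidable_less:
  assumes "computable n f" "computable n g" shows "decidable n (\<lambda>e. f e < g e)"
  using decidable_not[OF decidable_le[OF assms(2,1)]] by (simp add: not_le)

lemma decidable_eq:
  assumes "computable n f" "computable n g" shows "decidable n (\<lambda>e. f e = g e)"
proof -
  have "(\<lambda>e. f e = g e) = (\<lambda>e. f e \<le> g e \<and> g e \<le> f e)" by (auto simp: fun_eq_iff)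
  then show ?thesis by (simp only:) (intro decidable_conj decidable_le assms)
qed

text \<open>Bounded search is a recursion whose 0/1 value stays 1 after the first hit; it runs
  \<open>Suc c\<close> rounds because the bound is inclusive.\<close>

lemma decidable_ex_le:
  assumes b: "computable n b" and P: "decidable (Suc n) (\<lambda>e. P (e 0) (\<lambda>i. e (Suc i)))"
  shows "decidable n (\<lambda>e. \<exists>k\<le>b e. P k e)"
proof -
  have eq: "(if \<exists>k\<le>c. Q k then 1 else 0) =
      rec_nat 0 (\<lambda>k y. if y = 1 \<or> Q k then 1 else 0 :: nat) (Suc c)" for Q and c :: nat
  proof -
    have "rec_nat 0 (\<lambda>k y. if y = 1 \<or> Q k then 1 else 0 :: nat) c = (if \<exists>k<c. Q k then 1 else 0)" for c
      by (induction c) (auto simp: less_Suc_eq)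
    from this[of "Suc c"] show ?thesis by (simp only: less_Suc_eq_le)
  qed
  \<comment> \<open>In the recursion step slot 1 holds the previous value, so the parameters of
    \<open>P\<close> move one slot further.\<close>
  have "decidable (Suc (Suc n)) (\<lambda>e. P (e 0) (\<lambda>i. e (Suc (Suc i))))"
    using computable_compose[OF P[unfolded decidable_def],
        of "Suc (Suc n)" "\<lambda>i e. e (if i = 0 then 0 else Suc i)"]
    by (simp add: decidable_def computable_proj)
  then have "decidable (Suc (Suc n)) (\<lambda>e. e (Suc 0) = 1 \<or> P (e 0) (\<lambda>i. e (Suc (Suc i))))"
    by (intro decidable_disj decidable_eq computable_const computable_proj) simp_all
  then show ?thesis unfolding decidable_def eq
    by (intro computable_rec computable_Suc computable_const b) simp
qed

lemma decidable_all_le: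
  assumes b: "computable n b" and P: "decidable (Suc n) (\<lambda>e. P (e 0) (\<lambda>i. e (Suc i)))"
  shows "decidable n (\<lambda>e. \<forall>k\<le>b e. P k e)"
  using decidable_not[OF decidable_ex_le[OF b decidable_not[OF P]]] by simp

text \<open>Membership says that binary digit \<open>k\<close> of \<open>n\<close> is 1, i.e. that
  \<open>n div 2 ^ k\<close> is odd. Bounded quantifiers over \<open>q\<close> and the remainder
  \<open>r\<close> express this by sums, products and powers alone, which are known to be
  computable.\<close>

lemma mem_set_decode_iff:
  "k \<in> set_decode n \<longleftrightarrow> (\<exists>q\<le>n. \<exists>r\<le>n. r < 2 ^ k \<and> n = (2 * q + 1) * 2 ^ k + r)"
proof
  assume "k \<in> set_decode n"
  then obtain q where q: "n div 2 ^ k = 2 * q + 1"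
    by (auto simp: set_decode_def elim: oddE)
  have "n = (2 * q + 1) * 2 ^ k + n mod 2 ^ k" by (metis q div_mult_mod_eq)
  moreover have "q \<le> n" using q div_le_dividend[of n "2 ^ k"] by linarith
  ultimately show "\<exists>q\<le>n. \<exists>r\<le>n. r < 2 ^ k \<and> n = (2 * q + 1) * 2 ^ k + r"
    by (metis mod_less_divisor mod_less_eq_dividend zero_less_numeral zero_less_power)
next
  assume "\<exists>q\<le>n. \<exists>r\<le>n. r < 2 ^ k \<and> n = (2 * q + 1) * 2 ^ k + r"
  then obtain q r where r: "r < 2 ^ k" and n: "n = (2 * q + 1) * 2 ^ k + r" by blast
  have "n div 2 ^ k = 2 * q + 1" unfolding n using r by (subst div_mult_self3) auto
  then show "k \<in> set_decode n" by (simp add: set_decode_def)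
qed

lemma decidable_mem_set_decode:
  assumes "computable n f" "computable n g" shows "decidable n (\<lambda>e. f e \<in> set_decode (g e))"
proof -
  have "decidable 2 (\<lambda>e. e 0 \<in> set_decode (e 1))"
    unfolding mem_set_decode_iff
    by (intro decidable_ex_le decidable_conj decidable_less decidable_eq computable_power
        computable_add computable_mult computable_const computable_proj) simp_all
  then show ?thesis unfolding decidable_def by (rule computable_comp2) fact+
qed

lemmas computable_intros =
  computable_proj computable_Suc computable_const computable_add computable_power
  computable_prod_encode decidable_not decidable_conj decidable_disj decidable_imp
  decidable_le decidable_less decidable_eq decidable_ex_le decidable_all_le
  decidable_mem_set_decode

section \<open>Time warps\<close>

text \<open>The three clauses come from joins of two-element sets, of the empty set and of the set
  of all natural numbers. Conversely, a nonempty finite set has a maximum, which monotone maps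
  preserve, and an infinite set is cofinal in the natural numbers.\<close>

lemma time_warps_iff:
  "f \<in> time_warps \<longleftrightarrow> mono f \<and> f 0 = 0 \<and> f \<infinity> = (SUP n. f (enat n))"
proof
  assume f: "f \<in> time_warps"
  then have sup: "f (Sup A) = Sup (f ` A)" for A by (simp add: time_warps_def)
  have "mono f"
  proof
    fix x y :: enat assume "x \<le> y"
    then show "f x \<le> f y" using sup[of "{x, y}"] by (simp add: sup.absorb2 sup.order_iff sup.commute)
  qed
  moreover have "f 0 = 0" using sup[of "{}"] by (simp add: bot_enat_def)
  moreover have "Sup (range enat) = \<infinity>"
    by (simp add: Sup_enat_def finite_image_iff inj_on_def)
  then have "f \<infinity> = (SUP n. f (enat n))" using sup[of "range enat"] by (simp add: image_image)
  ultimately show "mono f \<and> f 0 = 0 \<and> f \<infinity> = (SUP n. f (enat n))" by blast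
next
  assume *: "mono f \<and> f 0 = 0 \<and> f \<infinity> = (SUP n. f (enat n))"
  show "f \<in> time_warps" unfolding time_warps_def
  proof (intro CollectI allI)
    fix A :: "enat set"
    consider "A = {}" | "A \<noteq> {}" "finite A" | "infinite A" by blast
    then show "f (Sup A) = Sup (f ` A)"
    proof cases
      case 1
      then show ?thesis using * by (simp add: bot_enat_def)
    next
      case 2
      then show ?thesis using * by (simp add: Sup_enat_def mono_Max_commute)
    next
      case 3
      have "f (enat n) \<le> Sup (f ` A)" for n
      proof -
        have "\<not> A \<subseteq> {..enat n}"
          using 3 finite_subset finite_enat_bounded[of "{..enat n}" n] by auto
        then obtain a where "a \<in> A" "enat n \<le> a" by (auto simp: subset_iff not_le intro: less_imp_le)
        then show ?thesis using * by (meson SUP_upper2 monoD)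
      qed
      then have "f \<infinity> \<le> Sup (f ` A)" using * by (simp add: SUP_least)
      moreover have "Sup (f ` A) \<le> f \<infinity>" using * by (intro SUP_least) (metis enat_ord_code(3) monoD)
      moreover have "Sup A = \<infinity>" using 3 by (auto simp: Sup_enat_def)
      ultimately show ?thesis by simp
    qed
  qed
qed

lemma time_warps_mono: "f \<in> time_warps \<Longrightarrow> x \<le> y \<Longrightarrow> f x \<le> f y"
  by (auto simp: time_warps_iff elim: monoD)

lemma time_warps_zero: "f \<in> time_warps \<Longrightarrow> f 0 = 0"
  by (simp add: time_warps_iff)

lemma time_warps_infinity: "f \<in> time_warps \<Longrightarrow> f \<infinity> = (SUP n. f (enat n))"
  by (simp add: time_warps_iff)

lemma time_warps_id: "id \<in> time_warps" by (simp add: time_warps_def)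

lemma time_warps_comp: "f \<in> time_warps \<Longrightarrow> g \<in> time_warps \<Longrightarrow> f \<circ> g \<in> time_warps"
  by (simp add: time_warps_def image_comp)

lemma time_warps_sup: "f \<in> time_warps \<Longrightarrow> g \<in> time_warps \<Longrightarrow> sup f g \<in> time_warps"
  by (simp add: time_warps_def complete_lattice_class.SUP_sup_distrib)

text \<open>Only continuity at \<infinity> needs care: the finite points at which \<open>f\<close>
  and \<open>g\<close> exceed a given bound may differ, but monotonicity moves both to the larger
  one.\<close>

lemma time_warps_inf:
  assumes f: "f \<in> time_warps" and g: "g \<in> time_warps"
  shows "inf f g \<in> time_warps"
  unfolding time_warps_iff
proof (intro conjI)
  show "mono (inf f g)"
    by (intro monoI) (auto intro: le_infI1 le_infI2 time_warps_mono[OF f] time_warps_mono[OF g])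
  show "inf f g 0 = 0" using f g by (simp add: time_warps_zero)
  let ?S = "SUP n. inf f g (enat n)"
  show "inf f g \<infinity> = ?S"
  proof (rule antisym)
    show "inf f g \<infinity> \<le> ?S"
    proof (rule ccontr)
      assume "\<not> inf f g \<infinity> \<le> ?S"
      then have "?S < (SUP n. f (enat n))" "?S < (SUP n. g (enat n))"
        using f g by (simp_all add: time_warps_infinity inf_enat_def not_le)
      then obtain m n where "?S < f (enat m)" "?S < g (enat n)" by (auto simp: less_SUP_iff)
      then have "?S < f (enat (max m n))" "?S < g (enat (max m n))"
        by (meson less_le_trans time_warps_mono[OF f] time_warps_mono[OF g]
            enat_ord_simps(1) max.cobounded1 max.cobounded2)+
      then have "?S < inf f g (enat (max m n))" by (simp add: inf_enat_def)
      also have "\<dots> \<le> ?S" by (rule SUP_upper) simp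
      finally show False by simp
    qed
    show "?S \<le> inf f g \<infinity>"
      unfolding inf_fun_def
      by (intro SUP_least inf_mono time_warps_mono[OF f] time_warps_mono[OF g]) simp_all
  qed
qed

section \<open>Explicit form of the involution\<close>

lemma tw_pred_Suc_le: "tw_pred (enat (Suc k)) \<le> enat k"
  unfolding tw_pred_def by (rule Sup_least) auto

text \<open>Continuity at \<infinity> holds because a finite value \<open>f y = enat k\<close>
  already lies below the finite point \<open>k + 1\<close>, so \<open>y\<close> is counted
  there.\<close>

lemma Sup_less_preimage_time_warp:
  assumes f: "f \<in> time_warps"
  shows "(\<lambda>x. Sup {y. f y < x}) \<in> time_warps"
  unfolding time_warps_iff
proof (intro conjI)
  show "mono (\<lambda>x. Sup {y. f y < x})" by (intro monoI Sup_subset_mono) auto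
  show "Sup {y. f y < 0} = 0" by (simp add: bot_enat_def)
  show "Sup {y. f y < \<infinity>} = (SUP n. Sup {y. f y < enat n})"
  proof (rule antisym)
    show "Sup {y. f y < \<infinity>} \<le> (SUP n. Sup {y. f y < enat n})"
    proof (rule Sup_least)
      fix y assume "y \<in> {y. f y < \<infinity>}"
      then obtain k where "f y = enat k" by auto
      then have "f y < enat (Suc k)" by simp
      then have "y \<le> Sup {y. f y < enat (Suc k)}" by (intro Sup_upper) simp
      also have "\<dots> \<le> (SUP n. Sup {y. f y < enat n})" by (rule SUP_upper) simp
      finally show "y \<le> (SUP n. Sup {y. f y < enat n})" .
    qed
    show "(SUP n. Sup {y. f y < enat n}) \<le> Sup {y. f y < \<infinity>}"
      by (intro SUP_least Sup_subset_mono) (auto dest: enat_iless)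
  qed
qed

text \<open>The supremum qualifies because \<open>f\<close> commutes with it and
  \<open>f y < x\<close> gives \<open>f y \<le> tw_pred x\<close>. It is the largest choice: at a
  finite \<open>n > 0\<close> the condition on \<open>h\<close> gives
  \<open>f (h n) \<le> n - 1 < n\<close>, so \<open>h n\<close> is among the elements joined; at
  \<infinity> the comparison follows by continuity.\<close>

lemma tw_star_eq:
  assumes f: "f \<in> time_warps"
  shows "tw_star f = (\<lambda>x. Sup {y. f y < x})"
  unfolding tw_star_def tw_resid_def
proof (rule Greatest_equality)
  let ?g = "\<lambda>x. Sup {y. f y < x}"
  have "f (?g x) \<le> tw_pred x" for x
  proof -
    have "f (?g x) = (SUP y\<in>{y. f y < x}. f y)" using f unfolding time_warps_def by blast
    also have "\<dots> \<le> tw_pred x"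
    proof (rule SUP_least)
      fix y assume "y \<in> {y. f y < x}"
      then show "f y \<le> tw_pred x" unfolding tw_pred_def
        by (cases "f y") (auto intro: Sup_upper)
    qed
    finally show ?thesis .
  qed
  then show "?g \<in> time_warps \<and> f \<circ> ?g \<le> tw_pred"
    using Sup_less_preimage_time_warp[OF f] by (auto simp: le_fun_def)
  fix h assume h: "h \<in> time_warps \<and> f \<circ> h \<le> tw_pred"
  have fin: "h (enat n) \<le> ?g (enat n)" for n
  proof (cases n)
    case 0
    then show ?thesis using h by (simp add: time_warps_zero flip: zero_enat_def)
  next
    case (Suc k)
    have "f (h (enat n)) \<le> enat k"
      using h tw_pred_Suc_le[of k] Suc by (auto simp: le_fun_def intro: order_trans)
    also have "\<dots> < enat n" using Suc by simp
    finally show ?thesis by (intro Sup_upper) simp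
  qed
  show "h \<le> ?g"
  proof (rule le_funI)
    fix x show "h x \<le> ?g x"
    proof (cases x)
      case (enat n)
      then show ?thesis using fin by simp
    next
      case infinity
      have "h \<infinity> = (SUP n. h (enat n))" using h by (simp add: time_warps_infinity)
      also have "\<dots> \<le> (SUP n. ?g (enat n))" by (intro SUP_mono') (rule fin)
      also have "\<dots> = ?g \<infinity>"
        using time_warps_infinity[OF Sup_less_preimage_time_warp[OF f]] by simp
      finally show ?thesis using infinity by simp
    qed
  qed
qed

lemma tw_star_time_warp: "f \<in> time_warps \<Longrightarrow> tw_star f \<in> time_warps"
  by (simp add: tw_star_eq Sup_less_preimage_time_warp)

lemma tw_eval_time_warp: "(\<And>i. \<sigma> i \<in> time_warps) \<Longrightarrow> tw_eval \<sigma> u \<in> time_warps"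
  by (induction u)
    (simp_all add: time_warps_id time_warps_comp time_warps_sup time_warps_inf tw_star_time_warp)

lemma tw_star_eq_enat_iff:
  assumes f: "f \<in> time_warps" and x: "x \<noteq> 0"
  shows "tw_star f x = enat y \<longleftrightarrow> f (enat y) < x \<and> x \<le> f (enat (Suc y))"
proof
  assume eq: "tw_star f x = enat y"
  \<comment> \<open>Since \<open>x\<close> is positive, the set contains 0; a finite supremum is
    therefore a maximum and is attained.\<close>
  have 0: "0 \<in> {y. f y < x}" using x by (simp add: time_warps_zero[OF f])
  have "enat y \<in> {y. f y < x}"
    using eq 0 Max_in[of "{y. f y < x}"]
    by (auto simp: tw_star_eq[OF f] Sup_enat_def split: if_splits)
  moreover have "enat (Suc y) \<notin> {y. f y < x}"
    using Sup_upper[of "enat (Suc y)" "{y. f y < x}"] eq by (auto simp: tw_star_eq[OF f])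
  ultimately show "f (enat y) < x \<and> x \<le> f (enat (Suc y))" by simp
next
  assume *: "f (enat y) < x \<and> x \<le> f (enat (Suc y))"
  have "w \<le> enat y" if "f w < x" for w
  proof (rule ccontr)
    assume "\<not> w \<le> enat y"
    then have "enat (Suc y) \<le> w" by (cases w) auto
    then have "x \<le> f w" using * time_warps_mono[OF f] order_trans by blast
    with that show False by simp
  qed
  then show "tw_star f x = enat y"
    unfolding tw_star_eq[OF f] using * by (intro antisym Sup_least Sup_upper) auto
qed

text \<open>The set joined in \<open>tw_star f x\<close> is downward closed, so it is unbounded
  exactly if it contains every natural number.\<close>

lemma tw_star_eq_infinity_iff:
  assumes f: "f \<in> time_warps"
  shows "tw_star f x = \<infinity> \<longleftrightarrow> (\<forall>m. f (enat m) < x)"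
proof
  assume eq: "tw_star f x = \<infinity>"
  show "\<forall>m. f (enat m) < x"
  proof
    fix m
    have "enat m < Sup {y. f y < x}" using eq by (simp add: tw_star_eq[OF f])
    then obtain w where "f w < x" "enat m < w" by (auto simp: less_Sup_iff)
    then show "f (enat m) < x" using time_warps_mono[OF f, of "enat m" w] le_less_trans less_imp_le
      by metis
  qed
next
  assume *: "\<forall>m. f (enat m) < x"
  show "tw_star f x = \<infinity>"
  proof (rule ccontr)
    assume "tw_star f x \<noteq> \<infinity>"
    then obtain y where y: "tw_star f x = enat y" by auto
    have "enat (Suc y) \<le> tw_star f x"
      unfolding tw_star_eq[OF f] using * by (intro Sup_upper) simp
    then show False by (simp add: y)
  qed
qed

text \<open>Strictness survives the supremum because values below \<open>k = j + 1\<close> are at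
  most \<open>j\<close>. Together with \<open>tw_star_eq_infinity_iff\<close> this replaces
  infinitely many conditions by one value at \<infinity>.\<close>

lemma time_warps_infinity_less_iff:
  assumes f: "f \<in> time_warps"
  shows "f \<infinity> < enat k \<longleftrightarrow> k \<noteq> 0 \<and> (\<forall>m. f (enat m) < enat k)"
proof
  assume "f \<infinity> < enat k"
  then show "k \<noteq> 0 \<and> (\<forall>m. f (enat m) < enat k)"
    using time_warps_mono[OF f, of _ \<infinity>] by (cases k) (auto simp: enat_0 intro: le_less_trans)
next
  assume *: "k \<noteq> 0 \<and> (\<forall>m. f (enat m) < enat k)"
  then obtain j where k: "k = Suc j" by (cases k) auto
  have "f \<infinity> \<le> enat j" unfolding time_warps_infinity[OF f]
  proof (rule SUP_least)
    fix m show "f (enat m) \<le> enat j" using * by (cases "f (enat m)") (auto simp: k less_Suc_eq_le dest: spec[of _ m])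
  qed
  also have "\<dots> < enat k" using k by simp
  finally show "f \<infinity> < enat k" .
qed

section \<open>Preservation of finiteness through the term operations\<close>

definition finite_preserving :: "(enat \<Rightarrow> enat) \<Rightarrow> bool" where
  "finite_preserving f \<longleftrightarrow> (\<forall>m. f (enat m) \<noteq> \<infinity>)"

lemma finite_preserving_sup:
  "finite_preserving (sup f g) \<longleftrightarrow> finite_preserving f \<and> finite_preserving g"
proof -
  have "sup x y \<noteq> \<infinity> \<longleftrightarrow> x \<noteq> \<infinity> \<and> y \<noteq> \<infinity>" for x y :: enat
    by (cases x; cases y) (auto simp: sup_enat_def)
  then show ?thesis by (auto simp: finite_preserving_def simp del: not_infinity_eq)
qed

text \<open>If \<open>f\<close> and \<open>g\<close> each reach \<infinity> at some finite point,
  both are infinite at the larger of these points.\<close>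

lemma finite_preserving_inf:
  assumes f: "f \<in> time_warps" and g: "g \<in> time_warps"
  shows "finite_preserving (inf f g) \<longleftrightarrow> finite_preserving f \<or> finite_preserving g"
proof
  assume *: "finite_preserving (inf f g)"
  show "finite_preserving f \<or> finite_preserving g"
  proof (rule ccontr)
    assume "\<not> (finite_preserving f \<or> finite_preserving g)"
    then obtain m n where "f (enat m) = \<infinity>" "g (enat n) = \<infinity>" by (auto simp: finite_preserving_def)
    then have "f (enat (max m n)) = \<infinity>" "g (enat (max m n)) = \<infinity>"
      using time_warps_mono[OF f, of "enat m" "enat (max m n)"]
        time_warps_mono[OF g, of "enat n" "enat (max m n)"] by simp_all
    then have "inf f g (enat (max m n)) = \<infinity>" by simp
    with * show False unfolding finite_preserving_def by blast
  qed
next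
  have "inf x y \<noteq> \<infinity> \<longleftrightarrow> x \<noteq> \<infinity> \<or> y \<noteq> \<infinity>" for x y :: enat
    by (cases x; cases y) (auto simp: inf_enat_def)
  then show "finite_preserving f \<or> finite_preserving g \<Longrightarrow> finite_preserving (inf f g)"
    by (auto simp: finite_preserving_def simp del: not_infinity_eq)
qed

text \<open>If \<open>f (g \<infinity>)\<close> is finite, it bounds the composite. If it is
  infinite and the composite preserves finiteness, then \<open>g\<close> never reaches
  \<open>g \<infinity>\<close> at a finite point. A finite supremum of natural numbers would be
  attained, so \<open>g \<infinity> = \<infinity>\<close>; the values of \<open>g\<close> are then
  finite and unbounded, and each \<open>f n\<close> lies below some finite
  \<open>f (g m)\<close>.\<close>

lemma finite_preserving_comp:
  assumes f: "f \<in> time_warps" and g: "g \<in> time_warps"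
  shows "finite_preserving (f \<circ> g) \<longleftrightarrow>
    f (g \<infinity>) \<noteq> \<infinity> \<or> (g \<infinity> = \<infinity> \<and> finite_preserving f \<and> finite_preserving g)"
proof
  assume fg: "finite_preserving (f \<circ> g)"
  show "f (g \<infinity>) \<noteq> \<infinity> \<or> (g \<infinity> = \<infinity> \<and> finite_preserving f \<and> finite_preserving g)"
  proof (cases "f (g \<infinity>) = \<infinity>")
    case True
    have less: "g (enat m) < g \<infinity>" for m
    proof -
      have "g (enat m) \<noteq> g \<infinity>" using True fg by (metis comp_apply finite_preserving_def)
      then show ?thesis using time_warps_mono[OF g, of "enat m" \<infinity>] by simp
    qed
    then have gfin: "finite_preserving g" unfolding finite_preserving_def by (metis enat_ord_simps(6))
    have ginf: "g \<infinity> = \<infinity>"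
    proof (rule ccontr)
      assume "g \<infinity> \<noteq> \<infinity>"
      then obtain k where k: "g \<infinity> = enat k" by auto
      then have "k \<noteq> 0 \<and> (\<forall>m. g (enat m) < enat k)"
        using less less[of 0] by (cases k) (auto simp: enat_0)
      then show False using time_warps_infinity_less_iff[OF g, of k] k by simp
    qed
    have "f (enat n) \<noteq> \<infinity>" for n
    proof -
      have "enat n < (SUP m. g (enat m))" using ginf time_warps_infinity[OF g] by simp
      then obtain m where "enat n < g (enat m)" by (auto simp: less_SUP_iff)
      then have "f (enat n) \<le> f (g (enat m))" by (intro time_warps_mono[OF f]) simp
      moreover have "f (g (enat m)) \<noteq> \<infinity>" using fg by (simp add: finite_preserving_def)
      ultimately show ?thesis by (metis enat_ord_simps(5))
    qed
    then show ?thesis using ginf gfin by (simp add: finite_preserving_def)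
  qed simp
next
  assume *: "f (g \<infinity>) \<noteq> \<infinity> \<or> (g \<infinity> = \<infinity> \<and> finite_preserving f \<and> finite_preserving g)"
  show "finite_preserving (f \<circ> g)" unfolding finite_preserving_def
  proof (intro allI notI)
    fix m assume inf: "(f \<circ> g) (enat m) = \<infinity>"
    then have "f (g \<infinity>) = \<infinity>"
      using time_warps_mono[OF f time_warps_mono[OF g, of "enat m" \<infinity>]] by simp
    with * have "finite_preserving f" "finite_preserving g" by auto
    then show False using inf by (metis comp_apply finite_preserving_def not_infinity_eq)
  qed
qed

text \<open>An infinite value of \<open>tw_star f\<close> at a finite point means that all
  \<open>f n\<close> lie below that point, i.e. that \<open>f\<close> is bounded by a natural
  number.\<close>

lemma finite_preserving_star:
  assumes f: "f \<in> time_warps"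
  shows "finite_preserving (tw_star f) \<longleftrightarrow> f \<infinity> = \<infinity>"
proof
  assume *: "finite_preserving (tw_star f)"
  show "f \<infinity> = \<infinity>"
  proof (rule ccontr)
    assume "f \<infinity> \<noteq> \<infinity>"
    then obtain k where "f \<infinity> < enat (Suc k)" by (cases "f \<infinity>") auto
    then have "tw_star f (enat (Suc k)) = \<infinity>"
      using time_warps_infinity_less_iff[OF f] tw_star_eq_infinity_iff[OF f] by blast
    with * show False unfolding finite_preserving_def by blast
  qed
next
  assume *: "f \<infinity> = \<infinity>"
  show "finite_preserving (tw_star f)" unfolding finite_preserving_def
  proof (intro allI notI)
    fix m assume "tw_star f (enat m) = \<infinity>"
    then have "\<forall>n. f (enat n) < enat m" using tw_star_eq_infinity_iff[OF f] by blast
    then have "m \<noteq> 0 \<and> (\<forall>n. f (enat n) < enat m)" by (cases m) (auto simp: enat_0)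
    then show False using * time_warps_infinity_less_iff[OF f, of m] by simp
  qed
qed

section \<open>Certificates\<close>

text \<open>\<open>R c x y\<close> is the claim that the term with code \<open>c\<close> maps \<open>x\<close> to \<open>y\<close>, and \<open>T c\<close> the claim that it
  preserves finiteness. Points are numbers up to \<open>M\<close>, where \<open>M\<close> itself stands for infinity.\<close>

definition var_ok :: "nat \<Rightarrow> (nat \<Rightarrow> nat \<Rightarrow> nat \<Rightarrow> bool) \<Rightarrow> (nat \<Rightarrow> bool) \<Rightarrow> nat \<Rightarrow> bool" where
  "var_ok M R T c \<longleftrightarrow> (\<forall>x\<le>M. \<forall>y\<le>M. R c x y \<longrightarrow>
      (x = 0 \<longrightarrow> y = 0) \<and> (T c \<and> x < M \<longrightarrow> y < M) \<and>
      (\<forall>x'\<le>M. \<forall>y'\<le>M. R c x' y' \<and> x \<le> x' \<longrightarrow> y \<le> y'))"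

definition one_ok :: "nat \<Rightarrow> (nat \<Rightarrow> nat \<Rightarrow> nat \<Rightarrow> bool) \<Rightarrow> nat \<Rightarrow> bool" where
  "one_ok M R c \<longleftrightarrow> (\<forall>x\<le>M. \<forall>y\<le>M. R c x y \<longrightarrow> x = y)"

text \<open>The alternatives follow \<open>tw_star_eq_enat_iff\<close> for finite values and
  \<open>tw_star_eq_infinity_iff\<close> for infinite ones, the latter through the value of
  \<open>a\<close> at \<infinity> if \<open>x\<close> is finite and through \<open>T a\<close>
  otherwise. \<open>Suc y < M\<close> keeps \<open>y\<close> and its successor finite, so that
  \<open>Suc\<close> has its usual meaning. The clause for \<open>T c\<close> is
  \<open>finite_preserving_star\<close>.\<close>

definition inv_ok ::
  "nat \<Rightarrow> (nat \<Rightarrow> nat \<Rightarrow> nat \<Rightarrow> bool) \<Rightarrow> (nat \<Rightarrow> bool) \<Rightarrow> nat \<Rightarrow> nat \<Rightarrow> bool" where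
  "inv_ok M R T c a \<longleftrightarrow> (T c \<longrightarrow> R a M M) \<and>
    (\<forall>x\<le>M. \<forall>y\<le>M. R c x y \<longrightarrow>
      (x = 0 \<and> y = 0) \<or>
      (0 < x \<and> Suc y < M \<and> (\<exists>v\<le>M. \<exists>w\<le>M. R a y v \<and> R a (Suc y) w \<and> v < x \<and> x \<le> w)) \<or>
      (y = M \<and> 0 < x \<and> x < M \<and> (\<exists>v\<le>M. R a M v \<and> v < x)) \<or>
      (x = M \<and> y = M \<and> T a))"

text \<open>Expressing the minimum by comparisons lets the condition survive order-preserving
  renumbering. The disjunction for \<open>T\<close> is that of
  \<open>finite_preserving_inf\<close>.\<close>

definition meet_ok ::
  "nat \<Rightarrow> (nat \<Rightarrow> nat \<Rightarrow> nat \<Rightarrow> bool) \<Rightarrow> (nat \<Rightarrow> bool) \<Rightarrow> nat \<Rightarrow> nat \<Rightarrow> nat \<Rightarrow> bool" where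
  "meet_ok M R T c a b \<longleftrightarrow> (T c \<longrightarrow> T a \<or> T b) \<and>
    (\<forall>x\<le>M. \<forall>y\<le>M. R c x y \<longrightarrow>
      (\<exists>v\<le>M. \<exists>w\<le>M. R a x v \<and> R b x w \<and> (y = v \<and> v \<le> w \<or> y = w \<and> w \<le> v)))"

definition join_ok ::
  "nat \<Rightarrow> (nat \<Rightarrow> nat \<Rightarrow> nat \<Rightarrow> bool) \<Rightarrow> (nat \<Rightarrow> bool) \<Rightarrow> nat \<Rightarrow> nat \<Rightarrow> nat \<Rightarrow> bool" where
  "join_ok M R T c a b \<longleftrightarrow> (T c \<longrightarrow> T a \<and> T b) \<and>
    (\<forall>x\<le>M. \<forall>y\<le>M. R c x y \<longrightarrow>
      (\<exists>v\<le>M. \<exists>w\<le>M. R a x v \<and> R b x w \<and> (y = w \<and> v \<le> w \<or> y = v \<and> w \<le> v)))"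

text \<open>The alternatives for \<open>T c\<close> are those of
  \<open>finite_preserving_comp\<close>, with \<open>w\<close> as the finite value of the composite
  at \<infinity>.\<close>

definition dot_ok ::
  "nat \<Rightarrow> (nat \<Rightarrow> nat \<Rightarrow> nat \<Rightarrow> bool) \<Rightarrow> (nat \<Rightarrow> bool) \<Rightarrow> nat \<Rightarrow> nat \<Rightarrow> nat \<Rightarrow> bool" where
  "dot_ok M R T c a b \<longleftrightarrow>
    (T c \<longrightarrow> (\<exists>v\<le>M. \<exists>w\<le>M. R b M v \<and> R a v w \<and> w < M) \<or> (R b M M \<and> T a \<and> T b)) \<and>
    (\<forall>x\<le>M. \<forall>y\<le>M. R c x y \<longrightarrow> (\<exists>v\<le>M. R b x v \<and> R a v y))"

text \<open>Quantifying over numbers instead of terms makes the property arithmetical. Numbers that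
  code no term do no harm: soundness looks only at codes of actual terms, and the certificates built
  below claim nothing about other numbers.\<close>

definition certificate :: "nat \<Rightarrow> nat \<Rightarrow> (nat \<Rightarrow> nat \<Rightarrow> nat \<Rightarrow> bool) \<Rightarrow> (nat \<Rightarrow> bool) \<Rightarrow> bool" where
  "certificate K M R T \<longleftrightarrow>
    (\<forall>i\<le>K. var_ok M R T (prod_encode (0, i))) \<and>
    one_ok M R (prod_encode (1, 0)) \<and>
    (\<forall>a\<le>K. inv_ok M R T (prod_encode (2, a)) a) \<and>
    (\<forall>a\<le>K. \<forall>b\<le>K.
      meet_ok M R T (prod_encode (3, prod_encode (a, b))) a b \<and>
      join_ok M R T (prod_encode (4, prod_encode (a, b))) a b \<and>
      dot_ok M R T (prod_encode (5, prod_encode (a, b))) a b)"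

section \<open>Soundness: realising a certificate by time warps\<close>

definition value_of :: "nat \<Rightarrow> nat \<Rightarrow> enat" where
  "value_of M x = (if x < M then enat x else \<infinity>)"

lemma value_of_le_iff: "x \<le> M \<Longrightarrow> y \<le> M \<Longrightarrow> value_of M x \<le> value_of M y \<longleftrightarrow> x \<le> y"
  by (auto simp: value_of_def)

lemma value_of_less_iff: "x \<le> M \<Longrightarrow> y \<le> M \<Longrightarrow> value_of M x < value_of M y \<longleftrightarrow> x < y"
  by (auto simp: value_of_def)

lemma value_of_eq_iff: "x \<le> M \<Longrightarrow> y \<le> M \<Longrightarrow> value_of M x = value_of M y \<longleftrightarrow> x = y"
  by (auto simp: value_of_def)

lemma value_of_self: "value_of M M = \<infinity>"
  by (simp add: value_of_def)

text \<open>The bound \<open>z + enat M\<close> keeps the extension of \<open>D\<close> finite at finite points if \<open>b\<close> holds, without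
  interfering with the values prescribed by \<open>D\<close>, which are below \<open>M\<close> at finite points in that case.\<close>

definition extend_warp :: "nat \<Rightarrow> (nat \<Rightarrow> nat \<Rightarrow> bool) \<Rightarrow> bool \<Rightarrow> enat \<Rightarrow> enat" where
  "extend_warp M D b z = (if z = 0 then 0 else
    min (Inf {value_of M y | x y. x \<le> M \<and> y \<le> M \<and> D x y \<and> z \<le> value_of M x})
      (if b then z + enat M else \<infinity>))"

text \<open>The infimum involves finitely many thresholds \<open>x\<close>, so it is constant once
  \<open>z\<close> has passed all finite ones. From there on at most the bound
  \<open>z + enat M\<close> varies, and it tends to \<infinity>.\<close>

lemma extend_warp_time_warp: "extend_warp M D b \<in> time_warps"
  unfolding time_warps_iff
proof (intro conjI)
  let ?f = "extend_warp M D b"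
  let ?I = "\<lambda>z. Inf {value_of M y | x y. x \<le> M \<and> y \<le> M \<and> D x y \<and> z \<le> value_of M x}"
  have zero: "?f 0 = 0" by (simp add: extend_warp_def)
  have eq: "?f z = min (?I z) (if b then z + enat M else \<infinity>)" if "z \<noteq> 0" for z
    using that by (simp only: extend_warp_def if_False)
  show mono: "mono ?f"
  proof
    fix w z :: enat assume "w \<le> z"
    then have "?I w \<le> ?I z" by (intro Inf_superset_mono) (auto intro: order_trans)
    moreover have "(if b then w + enat M else \<infinity>) \<le> (if b then z + enat M else \<infinity>)"
      using \<open>w \<le> z\<close> by (simp add: add_right_mono)
    ultimately have "min (?I w) (if b then w + enat M else \<infinity>) \<le> min (?I z) (if b then z + enat M else \<infinity>)"
      by (rule min.mono)
    note min_mono = this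
    show "?f w \<le> ?f z"
    proof (cases "w = 0")
      case True
      then show ?thesis by (simp only: zero i0_lb)
    next
      case False
      then have "z \<noteq> 0" using \<open>w \<le> z\<close> by auto
      show ?thesis unfolding eq[OF False] eq[OF \<open>z \<noteq> 0\<close>] by (rule min_mono)
    qed
  qed
  show "?f 0 = 0" by (fact zero)
  let ?S = "SUP n. ?f (enat n)"
  have le: "min (?I \<infinity>) (enat k) \<le> ?S" for k
  proof -
    \<comment> \<open>\<open>?n\<close> lies beyond every finite threshold, so only thresholds at
      \<infinity> remain; being at least \<open>k\<close>, it also keeps the bound from cutting
      below \<open>k\<close>.\<close>
    let ?n = "Suc (M + k)"
    have "enat ?n \<le> value_of M x \<longleftrightarrow> \<infinity> \<le> value_of M x" for x by (auto simp: value_of_def)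
    then have "?f (enat ?n) = min (?I \<infinity>) (if b then enat ?n + enat M else \<infinity>)"
      by (simp add: extend_warp_def enat_0_iff)
    moreover have "enat k \<le> (if b then enat ?n + enat M else \<infinity>)" by simp
    ultimately have "min (?I \<infinity>) (enat k) \<le> ?f (enat ?n)"
      by (simp only: min.mono[OF order_refl])
    also have "\<dots> \<le> ?S" by (rule SUP_upper) simp
    finally show ?thesis .
  qed
  have "?I \<infinity> \<le> ?S"
  proof (cases "?I \<infinity>")
    case (enat i)
    then show ?thesis using le[of i] by simp
  next
    case infinity
    then have "enat k \<le> ?S" for k using le[of k] by simp
    then have "?S = \<infinity>"
      by (metis Suc_n_not_le_n enat.exhaust enat_ord_simps(1))
    then show ?thesis by simp
  qed
  moreover have "?f \<infinity> = ?I \<infinity>" by (auto simp: extend_warp_def min_def)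
  moreover have "?S \<le> ?f \<infinity>" by (intro SUP_least monoD[OF mono]) simp
  ultimately show "?f \<infinity> = ?S" by simp
qed

lemma extend_warp_value_of:
  assumes M: "0 < M" and xy: "x \<le> M" "y \<le> M" "D x y"
    and zero: "x = 0 \<Longrightarrow> y = 0" and fin: "b \<Longrightarrow> x < M \<Longrightarrow> y < M"
    and mono: "\<And>x' y'. x' \<le> M \<Longrightarrow> y' \<le> M \<Longrightarrow> D x' y' \<Longrightarrow> x \<le> x' \<Longrightarrow> y \<le> y'"
  shows "extend_warp M D b (value_of M x) = value_of M y"
proof (cases "x = 0")
  case True
  then show ?thesis using zero M by (simp add: extend_warp_def value_of_def enat_0)
next
  case False
  have "Inf {value_of M y' | x' y'. x' \<le> M \<and> y' \<le> M \<and> D x' y' \<and> value_of M x \<le> value_of M x'} = value_of M y"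
  proof (rule antisym)
    show "Inf {value_of M y' | x' y'. x' \<le> M \<and> y' \<le> M \<and> D x' y' \<and> value_of M x \<le> value_of M x'} \<le> value_of M y"
      using xy by (intro Inf_lower) auto
    show "value_of M y \<le> Inf {value_of M y' | x' y'. x' \<le> M \<and> y' \<le> M \<and> D x' y' \<and> value_of M x \<le> value_of M x'}"
    proof (rule Inf_greatest, clarify)
      fix x' y' assume "x' \<le> M" "y' \<le> M" "D x' y'" "value_of M x \<le> value_of M x'"
      then show "value_of M y \<le> value_of M y'" using mono[of x' y'] xy by (simp add: value_of_le_iff)
    qed
  qed
  \<comment> \<open>For \<open>x = M\<close> the right-hand side is infinite; for smaller
    \<open>x\<close> the assumption gives \<open>y < M\<close>.\<close>
  moreover have "value_of M y \<le> value_of M x + enat M" if b using fin[OF that] xy by (auto simp: value_of_def)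
  moreover have "value_of M x \<noteq> 0" using False by (auto simp: value_of_def enat_0_iff)
  ultimately show ?thesis by (auto simp: extend_warp_def min_def)
qed

lemma extend_warp_finite_preserving: "finite_preserving (extend_warp M D True)"
  unfolding finite_preserving_def
proof
  fix m
  have "extend_warp M D True (enat m) \<le> enat m + enat M"
    by (simp add: extend_warp_def)
  then show "extend_warp M D True (enat m) \<noteq> \<infinity>"
    by (cases "extend_warp M D True (enat m)") simp_all
qed

lemma le_prod_encode_add: "a + b \<le> prod_encode (a, b)"
proof -
  have "n \<le> triangle n" for n by (induction n) auto
  from this[of "a + b"] show ?thesis by (simp add: prod_encode_def trans_le_add1)
qed

text \<open>Claims about variables hold by the choice of \<open>\<sigma>\<close>. For compound
  terms, \<open>value_of M\<close> is strictly increasing on numbers up to \<open>M\<close>, so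
  comparisons in the certificate become comparisons of values. Codes of subterms stay within
  \<open>K\<close> because a pair code bounds its components.\<close>

lemma certificate_sound:
  assumes cert: "certificate K M R T" and M: "0 < M"
  defines "\<sigma> \<equiv> \<lambda>i. extend_warp M (R (prod_encode (0, i))) (T (prod_encode (0, i)))"
  assumes "trm_code u \<le> K"
  shows "(\<forall>x\<le>M. \<forall>y\<le>M. R (trm_code u) x y \<longrightarrow> tw_eval \<sigma> u (value_of M x) = value_of M y) \<and>
    (T (trm_code u) \<longrightarrow> finite_preserving (tw_eval \<sigma> u))"
proof -
  have "\<sigma> i \<in> time_warps" for i by (simp add: \<sigma>_def extend_warp_time_warp)
  note tw = tw_eval_time_warp[of \<sigma>, OF this]
  show ?thesis using \<open>trm_code u \<le> K\<close>
  proof (induction u)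
    case (Var i)
    have i: "i \<le> K" using Var le_prod_encode_add[of 0 i] by simp
    have ok: "var_ok M R T (prod_encode (0, i))" using cert i by (simp add: certificate_def)
    have "tw_eval \<sigma> (Var i) (value_of M x) = value_of M y"
      if "x \<le> M" "y \<le> M" "R (prod_encode (0, i)) x y" for x y
    proof -
      have "(x = 0 \<longrightarrow> y = 0) \<and> (T (prod_encode (0, i)) \<and> x < M \<longrightarrow> y < M) \<and>
        (\<forall>x'\<le>M. \<forall>y'\<le>M. R (prod_encode (0, i)) x' y' \<and> x \<le> x' \<longrightarrow> y \<le> y')"
        using ok that unfolding var_ok_def by blast
      then show ?thesis unfolding \<sigma>_def tw_eval.simps
        using that by (intro extend_warp_value_of M) auto
    qed
    moreover have "finite_preserving (tw_eval \<sigma> (Var i))" if "T (prod_encode (0, i))"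
      using that extend_warp_finite_preserving by (simp add: \<sigma>_def)
    ultimately show ?case by simp
  next
    case One
    have "x = y" if "x \<le> M" "y \<le> M" "R (prod_encode (1, 0)) x y" for x y
      using cert that by (simp add: certificate_def one_ok_def)
    then show ?case by (auto simp: finite_preserving_def)
  next
    case (Inv a)
    have a: "trm_code a \<le> K" using Inv.prems le_prod_encode_add[of 2 "trm_code a"] by simp
    note IH = Inv.IH[OF a]
    have ok: "inv_ok M R T (trm_code (Inv a)) (trm_code a)"
      using cert a by (simp add: certificate_def)
    have T: "R (trm_code a) M M" if "T (trm_code (Inv a))"
      using ok that unfolding inv_ok_def by blast
    have "tw_eval \<sigma> (Inv a) (value_of M x) = value_of M y"
      if xy: "x \<le> M" "y \<le> M" and R: "R (trm_code (Inv a)) x y" for x y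
    proof -
      consider "x = 0" "y = 0"
        | v w where "0 < x" "Suc y < M" "v \<le> M" "w \<le> M" "R (trm_code a) y v"
            "R (trm_code a) (Suc y) w" "v < x" "x \<le> w"
        | v where "y = M" "0 < x" "x < M" "v \<le> M" "R (trm_code a) M v" "v < x"
        | "x = M" "y = M" "T (trm_code a)"
        using ok xy R unfolding inv_ok_def by blast
      then show ?thesis
      proof cases
        case 1
        then show ?thesis using M time_warps_zero[OF tw[of "Inv a"]] by (simp add: value_of_def enat_0)
      next
        case 2
        have "tw_eval \<sigma> a (value_of M y) = value_of M v" "tw_eval \<sigma> a (value_of M (Suc y)) = value_of M w"
          using IH 2 xy by auto
        moreover have "value_of M v < value_of M x" "value_of M x \<le> value_of M w"
          using 2 xy by (simp_all add: value_of_less_iff value_of_le_iff)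
        ultimately have "tw_eval \<sigma> a (enat y) < value_of M x \<and> value_of M x \<le> tw_eval \<sigma> a (enat (Suc y))"
          using 2 by (simp add: value_of_def)
        moreover have "value_of M x \<noteq> 0" using 2 by (auto simp: value_of_def enat_0_iff)
        ultimately show ?thesis using tw_star_eq_enat_iff[OF tw] 2 by (simp add: value_of_def)
      next
        case 3
        have "tw_eval \<sigma> a (value_of M M) = value_of M v" using IH 3 by blast
        then have "tw_eval \<sigma> a \<infinity> < enat x" using 3 by (simp add: value_of_def)
        then have "tw_star (tw_eval \<sigma> a) (enat x) = \<infinity>"
          using time_warps_infinity_less_iff[OF tw] tw_star_eq_infinity_iff[OF tw] by blast
        then show ?thesis using 3 by (simp add: value_of_def)
      next
        case 4
        then have "tw_star (tw_eval \<sigma> a) \<infinity> = \<infinity>"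
          using IH unfolding finite_preserving_def tw_star_eq_infinity_iff[OF tw]
          by (simp add: less_le)
        then show ?thesis using 4 by (simp add: value_of_def)
      qed
    qed
    moreover have "finite_preserving (tw_eval \<sigma> (Inv a))" if "T (trm_code (Inv a))"
    proof -
      have "tw_eval \<sigma> a (value_of M M) = value_of M M" using IH T[OF that] by blast
      then show ?thesis by (simp add: finite_preserving_star[OF tw] value_of_self)
    qed
    ultimately show ?case by blast
  next
    case (Meet a b)
    have ab: "trm_code a \<le> K" "trm_code b \<le> K"
      using Meet.prems le_prod_encode_add[of 3 "prod_encode (trm_code a, trm_code b)"]
        le_prod_encode_add[of "trm_code a" "trm_code b"] by simp_all
    note IH = Meet.IH(1)[OF ab(1)] Meet.IH(2)[OF ab(2)]
    have ok: "meet_ok M R T (trm_code (Meet a b)) (trm_code a) (trm_code b)"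
      using cert ab by (simp add: certificate_def)
    have T: "T (trm_code a) \<or> T (trm_code b)" if "T (trm_code (Meet a b))"
      using ok that unfolding meet_ok_def by blast
    have "tw_eval \<sigma> (Meet a b) (value_of M x) = value_of M y"
      if xy: "x \<le> M" "y \<le> M" and R: "R (trm_code (Meet a b)) x y" for x y
    proof -
      obtain v w where vw: "v \<le> M" "w \<le> M" "R (trm_code a) x v" "R (trm_code b) x w"
        and y: "y = v \<and> v \<le> w \<or> y = w \<and> w \<le> v"
        using ok xy R unfolding meet_ok_def by blast
      have "tw_eval \<sigma> a (value_of M x) = value_of M v" "tw_eval \<sigma> b (value_of M x) = value_of M w"
        using IH vw xy by auto
      then show ?thesis using vw y by (auto simp: value_of_le_iff inf_absorb1 inf_absorb2)
    qed
    moreover have "finite_preserving (tw_eval \<sigma> (Meet a b))" if "T (trm_code (Meet a b))"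
      using IH T[OF that] by (auto simp: finite_preserving_inf[OF tw tw])
    ultimately show ?case by blast
  next
    case (Join a b)
    have ab: "trm_code a \<le> K" "trm_code b \<le> K"
      using Join.prems le_prod_encode_add[of 4 "prod_encode (trm_code a, trm_code b)"]
        le_prod_encode_add[of "trm_code a" "trm_code b"] by simp_all
    note IH = Join.IH(1)[OF ab(1)] Join.IH(2)[OF ab(2)]
    have ok: "join_ok M R T (trm_code (Join a b)) (trm_code a) (trm_code b)"
      using cert ab by (simp add: certificate_def)
    have T: "T (trm_code a) \<and> T (trm_code b)" if "T (trm_code (Join a b))"
      using ok that unfolding join_ok_def by blast
    have "tw_eval \<sigma> (Join a b) (value_of M x) = value_of M y"
      if xy: "x \<le> M" "y \<le> M" and R: "R (trm_code (Join a b)) x y" for x y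
    proof -
      obtain v w where vw: "v \<le> M" "w \<le> M" "R (trm_code a) x v" "R (trm_code b) x w"
        and y: "y = w \<and> v \<le> w \<or> y = v \<and> w \<le> v"
        using ok xy R unfolding join_ok_def by blast
      have "tw_eval \<sigma> a (value_of M x) = value_of M v" "tw_eval \<sigma> b (value_of M x) = value_of M w"
        using IH vw xy by auto
      then show ?thesis using vw y by (auto simp: value_of_le_iff sup_absorb1 sup_absorb2)
    qed
    moreover have "finite_preserving (tw_eval \<sigma> (Join a b))" if "T (trm_code (Join a b))"
      using IH T[OF that] by (auto simp: finite_preserving_sup)
    ultimately show ?case by blast
  next
    case (Dot a b)
    have ab: "trm_code a \<le> K" "trm_code b \<le> K"
      using Dot.prems le_prod_encode_add[of 5 "prod_encode (trm_code a, trm_code b)"]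
        le_prod_encode_add[of "trm_code a" "trm_code b"] by simp_all
    note IH = Dot.IH(1)[OF ab(1)] Dot.IH(2)[OF ab(2)]
    have ok: "dot_ok M R T (trm_code (Dot a b)) (trm_code a) (trm_code b)"
      using cert ab by (simp add: certificate_def)
    have "tw_eval \<sigma> (Dot a b) (value_of M x) = value_of M y"
      if xy: "x \<le> M" "y \<le> M" and R: "R (trm_code (Dot a b)) x y" for x y
    proof -
      obtain v where "v \<le> M" "R (trm_code b) x v" "R (trm_code a) v y"
        using ok xy R unfolding dot_ok_def by blast
      then show ?thesis using IH xy by simp
    qed
    moreover have "finite_preserving (tw_eval \<sigma> (Dot a b))" if T: "T (trm_code (Dot a b))"
    proof -
      consider v w where "v \<le> M" "w \<le> M" "R (trm_code b) M v" "R (trm_code a) v w" "w < M"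
        | "R (trm_code b) M M" "T (trm_code a)" "T (trm_code b)"
        using ok T unfolding dot_ok_def by blast
      then show ?thesis
      proof cases
        case 1
        then have "tw_eval \<sigma> b (value_of M M) = value_of M v" "tw_eval \<sigma> a (value_of M v) = value_of M w"
          using IH by auto
        then have "tw_eval \<sigma> a (tw_eval \<sigma> b \<infinity>) = enat w" using 1 by (simp add: value_of_def)
        then show ?thesis by (simp add: finite_preserving_comp[OF tw tw])
      next
        case 2
        then have "tw_eval \<sigma> b (value_of M M) = value_of M M" using IH by blast
        then show ?thesis using IH 2 by (simp add: finite_preserving_comp[OF tw tw] value_of_self)
      qed
    qed
    ultimately show ?case by blast
  qed
qed

section \<open>Completeness: extracting a small certificate from a failing equation\<close>

text \<open>Term-point pairs at which values are consulted when justifying the value of \<open>u\<close> at \<open>x\<close>. The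
  point \<open>\<infinity>\<close> in the \<open>Inv\<close> case serves the claims about preservation of finiteness.\<close>

primrec needed :: "(nat \<Rightarrow> enat \<Rightarrow> enat) \<Rightarrow> trm \<Rightarrow> enat \<Rightarrow> (trm \<times> enat) set" where
  "needed \<sigma> (Var i) x = {(Var i, x)}"
| "needed \<sigma> One x = {(One, x)}"
| "needed \<sigma> (Inv a) x = insert (Inv a, x)
    (needed \<sigma> a \<infinity> \<union> needed \<sigma> a (tw_eval \<sigma> (Inv a) x) \<union>
      needed \<sigma> a (eSuc (tw_eval \<sigma> (Inv a) x)))"
| "needed \<sigma> (Meet a b) x = insert (Meet a b, x) (needed \<sigma> a x \<union> needed \<sigma> b x)"
| "needed \<sigma> (Join a b) x = insert (Join a b, x) (needed \<sigma> a x \<union> needed \<sigma> b x)"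
| "needed \<sigma> (Dot a b) x = insert (Dot a b, x) (needed \<sigma> b x \<union> needed \<sigma> a (tw_eval \<sigma> b x))"

lemma needed_self: "(u, x) \<in> needed \<sigma> u x"
  by (cases u) simp_all

text \<open>Provides, for each claim of the certificate built below, the claims about immediate
  subterms that justify it.\<close>

lemma needed_closed:
  assumes "(v, z) \<in> needed \<sigma> u x"
  shows "needed \<sigma> v z \<subseteq> needed \<sigma> u x"
  using assms by (induction u arbitrary: x) auto

lemma finite_needed: "finite (needed \<sigma> u x)"
  by (induction u arbitrary: x) simp_all

lemma add_le_prod_encode_trm_code:
  "trm_code a + k \<le> prod_encode (k, trm_code a)"
  "trm_code a + trm_code b + k \<le> prod_encode (k, prod_encode (trm_code a, trm_code b))"
  using le_prod_encode_add[of k "trm_code a"]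
    le_prod_encode_add[of k "prod_encode (trm_code a, trm_code b)"]
    le_prod_encode_add[of "trm_code a" "trm_code b"] by linarith+

lemma trm_code_needed: "(v, z) \<in> needed \<sigma> u x \<Longrightarrow> trm_code v \<le> trm_code u"
proof (induction u arbitrary: x)
  case (Inv a)
  then show ?case using add_le_prod_encode_trm_code(1)[of a 2] by fastforce
next
  case (Meet a b)
  then show ?case using add_le_prod_encode_trm_code(2)[of a b 3] by fastforce
next
  case (Join a b)
  then show ?case using add_le_prod_encode_trm_code(2)[of a b 4] by fastforce
next
  case (Dot a b)
  then show ?case using add_le_prod_encode_trm_code(2)[of a b 5] by fastforce
qed auto

text \<open>At a binary constructor cardinalities add while powers multiply, and
  \<open>4 * (m * n)\<close> dominates \<open>m + n + 1\<close> for positive \<open>m\<close> and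
  \<open>n\<close>. The slack of 2 in the exponent is paid for by the constructor's tag in the code,
  which is at least 3.\<close>

lemma card_insert_Un_le_power:
  assumes A: "card A \<le> 4 ^ Suc a" and B: "card B \<le> 4 ^ Suc b" and c: "a + b + 2 \<le> c"
  shows "card (insert z (A \<union> B)) \<le> 4 ^ Suc c"
proof -
  obtain p q :: nat where pq: "4 ^ Suc a = Suc p" "4 ^ Suc b = Suc q"
    by (metis gr0_implies_Suc zero_less_numeral zero_less_power)
  have "2 \<le> (4 ^ Suc a :: nat)" "2 \<le> (4 ^ Suc b :: nat)"
    using power_increasing[of 0 a "4 :: nat"] power_increasing[of 0 b "4 :: nat"] by simp_all
  then have pq1: "1 \<le> p" "1 \<le> q" unfolding pq by simp_all
  have "card (insert z (A \<union> B)) \<le> Suc (card A + card B)"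
    using card_Un_le[of A B] by (cases "finite (A \<union> B)") (simp_all add: card_insert_if)
  also have "\<dots> \<le> Suc (Suc p + Suc q)" using A B pq by simp
  also have "\<dots> \<le> 4 * (Suc p * Suc q)" using pq1 by simp
  also have "\<dots> = 4 ^ Suc (a + b + 2)"
    unfolding pq[symmetric] by (simp add: power_add)
  also have "\<dots> \<le> 4 ^ Suc c" using c by (intro power_increasing) simp_all
  finally show ?thesis .
qed

text \<open>The base is 4 because \<open>Inv\<close> consults its subterm at three points and adds
  one pair of its own, and \<open>3 * k + 1 \<le> 4 * k\<close> for positive
  \<open>k\<close>.\<close>

lemma card_needed: "card (needed \<sigma> u x) \<le> 4 ^ Suc (trm_code u)"
proof (induction u arbitrary: x)
  case (Inv a)
  let ?k = "4 ^ Suc (trm_code a) :: nat"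
  have "card (needed \<sigma> (Inv a) x) \<le> Suc (?k + ?k + ?k)"
    by (simp add: card_insert_if finite_needed del: power_Suc tw_eval.simps)
      (intro conjI impI le_SucI Suc_leI card_Un_le[THEN order_trans] add_mono Inv.IH; simp)
  also have "\<dots> \<le> 4 * ?k" by simp
  also have "\<dots> = 4 ^ Suc (Suc (trm_code a))" by simp
  also have "\<dots> \<le> 4 ^ Suc (trm_code (Inv a))"
    using add_le_prod_encode_trm_code(1)[of a 2] by (intro power_increasing) simp_all
  finally show ?case .
next
  case (Meet a b)
  show ?case unfolding needed.simps trm_code.simps
    using add_le_prod_encode_trm_code(2)[of a b 3]
    by (intro card_insert_Un_le_power[where a = "trm_code a" and b = "trm_code b"] Meet.IH) simp
next
  case (Join a b)
  show ?case unfolding needed.simps trm_code.simps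
    using add_le_prod_encode_trm_code(2)[of a b 4]
    by (intro card_insert_Un_le_power[where a = "trm_code a" and b = "trm_code b"] Join.IH) simp
next
  case (Dot a b)
  show ?case unfolding needed.simps trm_code.simps
    using add_le_prod_encode_trm_code(2)[of a b 5]
    by (intro card_insert_Un_le_power[where a = "trm_code b" and b = "trm_code a"] Dot.IH) simp
qed simp_all

text \<open>A finite number goes to its rank, the number of smaller elements of \<open>P\<close>,
  and \<infinity> goes to \<open>M\<close>, which exceeds all ranks. Passing from an element
  \<open>n\<close> of \<open>P\<close> to \<open>n + 1\<close> adds just \<open>n\<close> to the
  numbers counted, whether or not \<open>n + 1\<close> lies in \<open>P\<close>.\<close>

lemma compression:
  fixes P :: "enat set"
  assumes P: "finite P" and card: "card P < M" and zero: "0 \<in> P"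
  obtains \<kappa> :: "enat \<Rightarrow> nat" where
    "\<kappa> \<infinity> = M" "\<And>x. x \<noteq> \<infinity> \<Longrightarrow> \<kappa> x < M"
    "\<And>x y. x \<in> P \<Longrightarrow> y \<in> P \<Longrightarrow> \<kappa> x \<le> \<kappa> y \<longleftrightarrow> x \<le> y" "\<kappa> 0 = 0"
    "\<And>n. enat n \<in> P \<Longrightarrow> \<kappa> (enat (Suc n)) = Suc (\<kappa> (enat n))"
proof
  define V where "V = {n. enat n \<in> P}"
  have V: "finite V" and V_card: "card V < M"
  proof -
    have "enat ` V \<subseteq> P" by (auto simp: V_def)
    then show "finite V" using P by (meson finite_imageD finite_subset inj_onI enat.inject)
    have "card V = card (enat ` V)" by (simp add: card_image inj_on_def)
    also have "\<dots> \<le> card P" using P \<open>enat ` V \<subseteq> P\<close> by (rule card_mono)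
    finally show "card V < M" using card by simp
  qed
  define rank where "rank n = card {v \<in> V. v < n}" for n
  let ?\<kappa> = "\<lambda>x. case x of enat n \<Rightarrow> rank n | \<infinity> \<Rightarrow> M"
  have rank_less: "rank n < M" for n
    using card_mono[OF V, of "{v \<in> V. v < n}"] V_card unfolding rank_def by auto
  have rank_mono: "rank m \<le> rank n" if "m \<le> n" for m n
    unfolding rank_def using that V by (intro card_mono) auto
  have rank_Suc: "rank (Suc n) = Suc (rank n)" if "n \<in> V" for n
  proof -
    have "{v \<in> V. v < Suc n} = insert n {v \<in> V. v < n}" using that by auto
    then show ?thesis using V by (simp add: rank_def)
  qed
  show "?\<kappa> \<infinity> = M" by simp
  show "?\<kappa> x < M" if "x \<noteq> \<infinity>" for x using that rank_less by auto
  show "?\<kappa> 0 = 0" by (simp add: zero_enat_def rank_def)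
  show "?\<kappa> (enat (Suc n)) = Suc (?\<kappa> (enat n))" if "enat n \<in> P" for n
    using that rank_Suc by (simp add: V_def)
  show "?\<kappa> x \<le> ?\<kappa> y \<longleftrightarrow> x \<le> y" if "x \<in> P" "y \<in> P" for x y
  proof (cases x; cases y)
    fix m n assume xy: "x = enat m" "y = enat n"
    then have "n \<in> V" using that by (simp add: V_def)
    \<comment> \<open>If \<open>n < m\<close>, then \<open>n\<close> is counted in the rank of
      \<open>m\<close> but not in its own.\<close>
    then have "rank m \<le> rank n \<longleftrightarrow> m \<le> n"
      using rank_mono[of m n] rank_mono[of "Suc n" m] rank_Suc[of n] by fastforce
    then show ?thesis using xy by simp
  qed (use rank_less in \<open>auto simp: not_le less_imp_le\<close>)
qed

text \<open>The certificate consists of the true claims at the pairs in \<open>N\<close>, those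
  consulted when both sides are evaluated at \<open>x0\<close>, with all points renumbered by
  \<open>\<kappa>\<close>.\<close>

lemma certificate_complete:
  assumes \<sigma>: "\<And>i. \<sigma> i \<in> time_warps" and neq: "tw_eval \<sigma> s x0 \<noteq> tw_eval \<sigma> t x0"
  defines "K \<equiv> trm_code s + trm_code t"
  defines "M \<equiv> 4 ^ (K + 3)"
  obtains R T where "certificate K M R T"
    "\<And>c x y. R c x y \<Longrightarrow> c \<le> K \<and> x \<le> M \<and> y \<le> M" "\<And>c. T c \<Longrightarrow> c \<le> K"
    "\<exists>x\<le>M. \<exists>y\<le>M. \<exists>z\<le>M. R (trm_code s) x y \<and> R (trm_code t) x z \<and> y \<noteq> z"
proof -
  note tw = tw_eval_time_warp[of \<sigma>, OF \<sigma>]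
  define N where "N = needed \<sigma> s x0 \<union> needed \<sigma> t x0"
  have closed: "needed \<sigma> v z \<subseteq> N" if "(v, z) \<in> N" for v z
    using that needed_closed unfolding N_def by blast
  have N_inv: "(a, \<infinity>) \<in> N" "(a, tw_eval \<sigma> (Inv a) z) \<in> N" "(a, eSuc (tw_eval \<sigma> (Inv a) z)) \<in> N"
    if "(Inv a, z) \<in> N" for a z
    using closed[OF that] by (auto intro: needed_self)
  have N_meet: "(a, z) \<in> N" "(b, z) \<in> N" if "(Meet a b, z) \<in> N" for a b z
    using closed[OF that] by (auto intro: needed_self)
  have N_join: "(a, z) \<in> N" "(b, z) \<in> N" if "(Join a b, z) \<in> N" for a b z
    using closed[OF that] by (auto intro: needed_self)
  have N_dot: "(b, z) \<in> N" "(a, tw_eval \<sigma> b z) \<in> N" if "(Dot a b, z) \<in> N" for a b z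
    using closed[OF that] by (auto intro: needed_self)
  have finN: "finite N" by (simp add: N_def finite_needed)
  have N_code: "trm_code v \<le> K" if "(v, z) \<in> N" for v z
    using that trm_code_needed unfolding N_def K_def by fastforce
  \<comment> \<open>Besides all arguments and values in play, \<open>P\<close> contains 0 so that
    renumbering reflects being zero.\<close>
  define P where "P = insert 0 (snd ` N \<union> (\<lambda>(u, x). tw_eval \<sigma> u x) ` N)"
  have finP: "finite P" using finN by (simp add: P_def)
  have P_arg: "z \<in> P" and P_val: "tw_eval \<sigma> v z \<in> P" if "(v, z) \<in> N" for v z
    using that by (force simp: P_def)+
  \<comment> \<open>\<open>N\<close> has at most \<open>2 * 4 ^ (K + 1) = 8 * 4 ^ K\<close> pairs,
    so \<open>P\<close> has at most \<open>16 * 4 ^ K + 1\<close> elements, fewer than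
    \<open>M = 64 * 4 ^ K\<close>.\<close>
  have cardP: "card P < M"
  proof -
    have N: "card N \<le> 4 ^ Suc (trm_code s) + 4 ^ Suc (trm_code t)"
      unfolding N_def by (intro card_Un_le[THEN order_trans] add_mono card_needed)
    have pow: "(4 :: nat) ^ Suc (trm_code s) \<le> 4 ^ Suc K" "(4 :: nat) ^ Suc (trm_code t) \<le> 4 ^ Suc K"
      unfolding K_def by (intro power_increasing; simp)+
    have M64: "M = 64 * 4 ^ K" by (simp add: M_def power_add)
    have K1: "(1 :: nat) \<le> 4 ^ K" by simp
    have "card P \<le> Suc (card (snd ` N \<union> (\<lambda>(u, x). tw_eval \<sigma> u x) ` N))"
      unfolding P_def using finN by (simp add: card_insert_if)
    also have "\<dots> \<le> Suc (card N + card N)"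
      by (intro Suc_le_mono[THEN iffD2] card_Un_le[THEN order_trans] add_mono card_image_le finN)
    also have "\<dots> \<le> Suc (4 * 4 ^ Suc K)" using N pow by linarith
    also have "\<dots> < M" unfolding M64 power_Suc using K1 by linarith
    finally show ?thesis .
  qed
  obtain \<kappa> :: "enat \<Rightarrow> nat" where inf: "\<kappa> \<infinity> = M" and fin: "\<And>x. x \<noteq> \<infinity> \<Longrightarrow> \<kappa> x < M"
    and le: "\<And>x y. x \<in> P \<Longrightarrow> y \<in> P \<Longrightarrow> \<kappa> x \<le> \<kappa> y \<longleftrightarrow> x \<le> y" and \<kappa>0: "\<kappa> 0 = 0"
    and \<kappa>_Suc: "\<And>n. enat n \<in> P \<Longrightarrow> \<kappa> (enat (Suc n)) = Suc (\<kappa> (enat n))"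
    using compression[OF finP cardP] unfolding P_def by blast
  have \<kappa>_le: "\<kappa> x \<le> M" for x using inf fin by (metis less_imp_le order_refl)
  have \<kappa>_M: "\<kappa> x < M \<longleftrightarrow> x \<noteq> \<infinity>" "\<kappa> x = M \<longleftrightarrow> x = \<infinity>" for x
    using inf fin by (metis less_irrefl)+
  have less: "\<kappa> x < \<kappa> y \<longleftrightarrow> x < y" if "x \<in> P" "y \<in> P" for x y
    using le[OF that(2,1)] by (simp add: not_le[symmetric])
  have eq: "\<kappa> x = \<kappa> y \<longleftrightarrow> x = y" if "x \<in> P" "y \<in> P" for x y
    using le[OF that] le[OF that(2,1)] by (metis antisym order_refl)
  have zeroP: "0 \<in> P" by (simp add: P_def)
  have \<kappa>_0: "\<kappa> x = 0 \<longleftrightarrow> x = 0" if "x \<in> P" for x using eq[OF that zeroP] \<kappa>0 by simp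
  define R where "R c x y \<longleftrightarrow> (\<exists>v z. (v, z) \<in> N \<and> c = trm_code v \<and> x = \<kappa> z \<and> y = \<kappa> (tw_eval \<sigma> v z))"
    for c x y
  \<comment> \<open>Requiring the pair with \<infinity> in \<open>N\<close> ensures that the values
    at \<infinity> demanded by the conditions on \<open>T\<close> are recorded as well.\<close>
  define T where "T c \<longleftrightarrow> (\<exists>v. (v, \<infinity>) \<in> N \<and> c = trm_code v \<and> finite_preserving (tw_eval \<sigma> v))"
    for c
  have RI: "R (trm_code v) (\<kappa> z) (\<kappa> (tw_eval \<sigma> v z))" if "(v, z) \<in> N" for v z
    using that unfolding R_def by blast
  have TI: "T (trm_code v)" if "(v, \<infinity>) \<in> N" "finite_preserving (tw_eval \<sigma> v)" for v
    using that unfolding T_def by blast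
  \<comment> \<open>\<open>R\<close> and \<open>T\<close> see only codes. The tag of a code
    determines the outermost constructor, so each claim can be traced back to a pair in
    \<open>N\<close> of the right shape.\<close>
  have code0: "v = Var i" if "trm_code v = prod_encode (0, i)" for v i
    using that by (cases v) simp_all
  have code1: "v = One" if "trm_code v = prod_encode (1, 0)" for v
    using that by (cases v) simp_all
  have code2: "\<exists>a. v = Inv a \<and> a' = trm_code a" if "trm_code v = prod_encode (2, a')" for v a'
    using that by (cases v) simp_all
  have code3: "\<exists>a b. v = Meet a b \<and> a' = trm_code a \<and> b' = trm_code b"
    if "trm_code v = prod_encode (3, prod_encode (a', b'))" for v a' b'
    using that by (cases v) simp_all
  have code4: "\<exists>a b. v = Join a b \<and> a' = trm_code a \<and> b' = trm_code b"
    if "trm_code v = prod_encode (4, prod_encode (a', b'))" for v a' b'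
    using that by (cases v) simp_all
  have code5: "\<exists>a b. v = Dot a b \<and> a' = trm_code a \<and> b' = trm_code b"
    if "trm_code v = prod_encode (5, prod_encode (a', b'))" for v a' b'
    using that by (cases v) simp_all
  have var: "var_ok M R T (prod_encode (0, i))" for i
    unfolding var_ok_def
  proof (intro allI impI)
    fix x y assume "R (prod_encode (0, i)) x y"
    then obtain z where z: "(Var i, z) \<in> N" and xy: "x = \<kappa> z" "y = \<kappa> (\<sigma> i z)"
      unfolding R_def using code0 by (metis tw_eval.simps(1))
    note P = P_arg[OF z] P_val[OF z, simplified]
    have "x = 0 \<longrightarrow> y = 0" using xy \<kappa>_0[OF P(1)] \<kappa>0 time_warps_zero[OF \<sigma>] by simp
    moreover have "y < M" if "T (prod_encode (0, i))" "x < M"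
    proof -
      have "finite_preserving (\<sigma> i)"
        using that(1) unfolding T_def using code0 by (metis tw_eval.simps(1))
      moreover have "z \<noteq> \<infinity>" using that(2) xy \<kappa>_M by simp
      ultimately show ?thesis using xy \<kappa>_M unfolding finite_preserving_def by (metis not_infinity_eq)
    qed
    moreover have "y \<le> y'" if R': "R (prod_encode (0, i)) x' y'" and "x \<le> x'" for x' y'
    proof -
      obtain z' where z': "(Var i, z') \<in> N" and xy': "x' = \<kappa> z'" "y' = \<kappa> (\<sigma> i z')"
        using R' unfolding R_def using code0 by (metis tw_eval.simps(1))
      have "z \<le> z'" using \<open>x \<le> x'\<close> xy xy' le[OF P(1) P_arg[OF z']] by simp
      then show ?thesis
        using xy xy' le[OF P(2) P_val[OF z', simplified]] time_warps_mono[OF \<sigma>] by simp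
    qed
    ultimately show "(x = 0 \<longrightarrow> y = 0) \<and> (T (prod_encode (0, i)) \<and> x < M \<longrightarrow> y < M) \<and>
      (\<forall>x'\<le>M. \<forall>y'\<le>M. R (prod_encode (0, i)) x' y' \<and> x \<le> x' \<longrightarrow> y \<le> y')" by blast
  qed
  have one: "one_ok M R (prod_encode (1, 0))"
    unfolding one_ok_def R_def using code1 by (metis id_apply tw_eval.simps(6))
  have inv: "inv_ok M R T (prod_encode (2, a')) a'" for a'
    unfolding inv_ok_def
  proof (intro conjI allI impI)
    assume "T (prod_encode (2, a'))"
    then obtain a where a: "(Inv a, \<infinity>) \<in> N" "a' = trm_code a" "finite_preserving (tw_star (tw_eval \<sigma> a))"
      unfolding T_def using code2 by (metis tw_eval.simps(5))
    then have "tw_eval \<sigma> a \<infinity> = \<infinity>" using finite_preserving_star[OF tw] by blast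
    then show "R a' M M" using RI[OF N_inv(1)[OF a(1)]] a(2) inf by simp
  next
    fix x y assume "R (prod_encode (2, a')) x y"
    then obtain a z where a: "(Inv a, z) \<in> N" and a': "a' = trm_code a"
      and xy: "x = \<kappa> z" "y = \<kappa> (tw_eval \<sigma> (Inv a) z)"
      unfolding R_def using code2 by metis
    note Na = N_inv[OF a]
    show "(x = 0 \<and> y = 0) \<or>
      (0 < x \<and> Suc y < M \<and> (\<exists>v\<le>M. \<exists>w\<le>M. R a' y v \<and> R a' (Suc y) w \<and> v < x \<and> x \<le> w)) \<or>
      (y = M \<and> 0 < x \<and> x < M \<and> (\<exists>v\<le>M. R a' M v \<and> v < x)) \<or>
      (x = M \<and> y = M \<and> T a')"
    proof (cases "z = 0")
      case True
      then show ?thesis using xy \<kappa>0 time_warps_zero[OF tw, of "Inv a"] by simp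
    next
      case False
      then have x0: "0 < x" using xy \<kappa>_0[OF P_arg[OF a]] by simp
      show ?thesis
      proof (cases "tw_eval \<sigma> (Inv a) z")
        case (enat n)
        then have *: "tw_eval \<sigma> a (enat n) < z" "z \<le> tw_eval \<sigma> a (enat (Suc n))"
          using tw_star_eq_enat_iff[OF tw False] by simp_all
        have N': "(a, enat n) \<in> N" "(a, enat (Suc n)) \<in> N"
          using Na enat by (simp_all add: eSuc_enat)
        \<comment> \<open>\<open>enat n\<close> lies in \<open>P\<close>, so renumbering commutes
          with its successor, and the image of the finite point \<open>n + 1\<close> stays below
          \<open>M\<close>.\<close>
        have y: "y = \<kappa> (enat n)" "Suc y = \<kappa> (enat (Suc n))"
          using xy enat \<kappa>_Suc[OF P_arg[OF N'(1)]] by simp_all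
        have "Suc y < M" using y(2) \<kappa>_M by simp
        moreover have "R a' y (\<kappa> (tw_eval \<sigma> a (enat n)))"
          "R a' (Suc y) (\<kappa> (tw_eval \<sigma> a (enat (Suc n))))"
          using RI[OF N'(1)] RI[OF N'(2)] a' y by simp_all
        moreover have "\<kappa> (tw_eval \<sigma> a (enat n)) < x" "x \<le> \<kappa> (tw_eval \<sigma> a (enat (Suc n)))"
          using * xy less[OF P_val[OF N'(1)] P_arg[OF a]] le[OF P_arg[OF a] P_val[OF N'(2)]] by simp_all
        ultimately show ?thesis using x0 \<kappa>_le by blast
      next
        case infinity
        then have y: "y = M" using xy inf by simp
        have all: "\<forall>m. tw_eval \<sigma> a (enat m) < z"
          using infinity tw_star_eq_infinity_iff[OF tw] by simp
        show ?thesis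
        proof (cases z)
          case (enat k)
          then have "tw_eval \<sigma> a \<infinity> < z"
            using all False time_warps_infinity_less_iff[OF tw, of a k] by (simp add: enat_0_iff)
          then have "\<kappa> (tw_eval \<sigma> a \<infinity>) < x"
            using xy less[OF P_val[OF Na(1)] P_arg[OF a]] by simp
          moreover have "R a' M (\<kappa> (tw_eval \<sigma> a \<infinity>))" using RI[OF Na(1)] a' inf by simp
          moreover have "x < M" using xy \<kappa>_M enat by simp
          ultimately show ?thesis using x0 y \<kappa>_le by blast
        next
          case infinity
          then have "finite_preserving (tw_eval \<sigma> a)"
            using all unfolding finite_preserving_def by (metis less_irrefl)
          then have "T a'" using TI[OF Na(1)] a' by simp
          then show ?thesis using infinity xy inf y by simp
        qed
      qed
    qed
  qed
  have meet: "meet_ok M R T (prod_encode (3, prod_encode (a', b'))) a' b'" for a' b'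
    unfolding meet_ok_def
  proof (intro conjI allI impI)
    assume "T (prod_encode (3, prod_encode (a', b')))"
    then obtain a b where ab: "(Meet a b, \<infinity>) \<in> N" "a' = trm_code a" "b' = trm_code b"
      and fp: "finite_preserving (inf (tw_eval \<sigma> a) (tw_eval \<sigma> b))"
      unfolding T_def using code3 by (metis tw_eval.simps(2))
    show "T a' \<or> T b'"
      using fp TI N_meet[OF ab(1)] ab(2,3) unfolding finite_preserving_inf[OF tw tw] by blast
  next
    fix x y assume "R (prod_encode (3, prod_encode (a', b'))) x y"
    then obtain a b z where ab: "(Meet a b, z) \<in> N" "a' = trm_code a" "b' = trm_code b"
      and xy: "x = \<kappa> z" "y = \<kappa> (tw_eval \<sigma> (Meet a b) z)"
      unfolding R_def using code3 by metis
    note Nab = N_meet[OF ab(1)]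
    let ?v = "tw_eval \<sigma> a z" and ?w = "tw_eval \<sigma> b z"
    have "R a' x (\<kappa> ?v)" "R b' x (\<kappa> ?w)" using RI Nab ab xy by simp_all
    moreover have "y = \<kappa> ?v \<and> \<kappa> ?v \<le> \<kappa> ?w \<or> y = \<kappa> ?w \<and> \<kappa> ?w \<le> \<kappa> ?v"
      using xy le[OF P_val[OF Nab(1)] P_val[OF Nab(2)]] le[OF P_val[OF Nab(2)] P_val[OF Nab(1)]]
      by (auto simp: inf_enat_def min_def)
    ultimately show "\<exists>v\<le>M. \<exists>w\<le>M. R a' x v \<and> R b' x w \<and> (y = v \<and> v \<le> w \<or> y = w \<and> w \<le> v)"
      using \<kappa>_le by blast
  qed
  have join: "join_ok M R T (prod_encode (4, prod_encode (a', b'))) a' b'" for a' b'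
    unfolding join_ok_def
  proof (rule conjI; intro allI impI)
    assume "T (prod_encode (4, prod_encode (a', b')))"
    then obtain a b where ab: "(Join a b, \<infinity>) \<in> N" "a' = trm_code a" "b' = trm_code b"
      and fp: "finite_preserving (sup (tw_eval \<sigma> a) (tw_eval \<sigma> b))"
      unfolding T_def using code4 by (metis tw_eval.simps(3))
    show "T a' \<and> T b'"
      using fp TI N_join[OF ab(1)] ab(2,3) unfolding finite_preserving_sup by blast
  next
    fix x y assume "R (prod_encode (4, prod_encode (a', b'))) x y"
    then obtain a b z where ab: "(Join a b, z) \<in> N" "a' = trm_code a" "b' = trm_code b"
      and xy: "x = \<kappa> z" "y = \<kappa> (tw_eval \<sigma> (Join a b) z)"
      unfolding R_def using code4 by metis
    note Nab = N_join[OF ab(1)]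
    let ?v = "tw_eval \<sigma> a z" and ?w = "tw_eval \<sigma> b z"
    have "R a' x (\<kappa> ?v)" "R b' x (\<kappa> ?w)" using RI Nab ab xy by simp_all
    moreover have "y = \<kappa> ?w \<and> \<kappa> ?v \<le> \<kappa> ?w \<or> y = \<kappa> ?v \<and> \<kappa> ?w \<le> \<kappa> ?v"
      using xy le[OF P_val[OF Nab(1)] P_val[OF Nab(2)]] le[OF P_val[OF Nab(2)] P_val[OF Nab(1)]]
      by (auto simp: sup_enat_def max_def)
    ultimately show "\<exists>v\<le>M. \<exists>w\<le>M. R a' x v \<and> R b' x w \<and> (y = w \<and> v \<le> w \<or> y = v \<and> w \<le> v)"
      using \<kappa>_le by blast
  qed
  have dot: "dot_ok M R T (prod_encode (5, prod_encode (a', b'))) a' b'" for a' b'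
    unfolding dot_ok_def
  proof (intro conjI allI impI)
    assume "T (prod_encode (5, prod_encode (a', b')))"
    then obtain a b where ab: "(Dot a b, \<infinity>) \<in> N" "a' = trm_code a" "b' = trm_code b"
      and fp: "finite_preserving (tw_eval \<sigma> a \<circ> tw_eval \<sigma> b)"
      unfolding T_def using code5 by (metis tw_eval.simps(4))
    note Nab = N_dot[OF ab(1)]
    let ?v = "tw_eval \<sigma> b \<infinity>"
    let ?w = "tw_eval \<sigma> a ?v"
    have R: "R b' M (\<kappa> ?v)" "R a' (\<kappa> ?v) (\<kappa> ?w)" using RI[OF Nab(1)] RI[OF Nab(2)] ab inf by simp_all
    from fp consider "?w \<noteq> \<infinity>"
      | "?v = \<infinity>" "finite_preserving (tw_eval \<sigma> a)" "finite_preserving (tw_eval \<sigma> b)"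
      unfolding finite_preserving_comp[OF tw tw] by metis
    then show "(\<exists>v\<le>M. \<exists>w\<le>M. R b' M v \<and> R a' v w \<and> w < M) \<or> (R b' M M \<and> T a' \<and> T b')"
    proof cases
      case 1
      then have "\<kappa> ?w < M" by (rule fin)
      then show ?thesis using R \<kappa>_le by blast
    next
      case 2
      then have "T a'" "T b'" using TI Nab ab by simp_all
      then show ?thesis using R 2 inf by simp
    qed
  next
    fix x y assume "R (prod_encode (5, prod_encode (a', b'))) x y"
    then obtain a b z where ab: "(Dot a b, z) \<in> N" "a' = trm_code a" "b' = trm_code b"
      and xy: "x = \<kappa> z" "y = \<kappa> (tw_eval \<sigma> (Dot a b) z)"
      unfolding R_def using code5 by metis
    note Nab = N_dot[OF ab(1)]
    have "R b' x (\<kappa> (tw_eval \<sigma> b z))" "R a' (\<kappa> (tw_eval \<sigma> b z)) y"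
      using RI[OF Nab(1)] RI[OF Nab(2)] ab xy by simp_all
    then show "\<exists>v\<le>M. R b' x v \<and> R a' v y" using \<kappa>_le by blast
  qed
  have st: "(s, x0) \<in> N" "(t, x0) \<in> N" by (simp_all add: N_def needed_self)
  show thesis
  proof (rule that)
    show "certificate K M R T"
      unfolding certificate_def using var one inv meet join dot by blast
    show "c \<le> K \<and> x \<le> M \<and> y \<le> M" if "R c x y" for c x y
      using that N_code \<kappa>_le unfolding R_def by blast
    show "c \<le> K" if "T c" for c using that N_code unfolding T_def by blast
    have "\<kappa> (tw_eval \<sigma> s x0) \<noteq> \<kappa> (tw_eval \<sigma> t x0)"
      using neq eq[OF P_val[OF st(1)] P_val[OF st(2)]] by simp
    then show "\<exists>x\<le>M. \<exists>y\<le>M. \<exists>z\<le>M. R (trm_code s) x y \<and> R (trm_code t) x z \<and> y \<noteq> z"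
      using RI[OF st(1)] RI[OF st(2)] \<kappa>_le by blast
  qed
qed

section \<open>The decision procedure\<close>

text \<open>Coding the finitely many claims as binary digits of \<open>S\<close> and
  \<open>T\<close> turns the search for a certificate into a search for numbers.\<close>

definition refutation :: "nat \<Rightarrow> nat \<Rightarrow> nat \<Rightarrow> nat \<Rightarrow> nat \<Rightarrow> bool" where
  "refutation c d M S T \<longleftrightarrow>
    certificate (c + d) M (\<lambda>u x y. prod_encode (u, prod_encode (x, y)) \<in> set_decode S)
      (\<lambda>u. u \<in> set_decode T) \<and>
    (\<exists>x\<le>M. \<exists>y\<le>M. \<exists>z\<le>M. prod_encode (c, prod_encode (x, y)) \<in> set_decode S \<and>
      prod_encode (d, prod_encode (x, z)) \<in> set_decode S \<and> y \<noteq> z)"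

text \<open>The range of \<open>M\<close> ends at the value used in
  \<open>certificate_complete\<close>, and \<open>0 < M\<close> makes 0 a finite point, as soundness
  requires. The codes of claims are then at most
  \<open>prod_encode (c + d, prod_encode (M, M))\<close>, which limits the binary digits of
  \<open>S\<close> and \<open>T\<close>.\<close>

definition refutable :: "nat \<Rightarrow> nat \<Rightarrow> bool" where
  "refutable c d \<longleftrightarrow> (\<exists>M\<le>4 ^ (c + d + 3). 0 < M \<and>
    (\<exists>S\<le>2 ^ Suc (prod_encode (c + d, prod_encode (M, M))).
     \<exists>T\<le>2 ^ Suc (prod_encode (c + d, prod_encode (M, M))). refutation c d M S T))"

lemma set_encode_le:
  assumes "A \<subseteq> {..n}" shows "set_encode A \<le> 2 ^ Suc n"
proof -
  have "set_encode A \<le> (\<Sum>k\<in>{..n}. 2 ^ k)"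
    unfolding set_encode_def using assms by (intro sum_mono2) auto
  also have "\<dots> \<le> 2 ^ Suc n" by (induction n) auto
  finally show ?thesis .
qed

lemma prod_encode_mono: "a \<le> a' \<Longrightarrow> b \<le> b' \<Longrightarrow> prod_encode (a, b) \<le> prod_encode (a', b')"
proof -
  have "triangle m \<le> triangle n" if "m \<le> n" for m n
    using that by (induction rule: dec_induct) auto
  then show "a \<le> a' \<Longrightarrow> b \<le> b' \<Longrightarrow> ?thesis" by (simp add: prod_encode_def add_mono)
qed

lemma refutable_iff: "refutable (trm_code s) (trm_code t) \<longleftrightarrow> \<not> W_models s t"
proof
  assume "refutable (trm_code s) (trm_code t)"
  then obtain M S T where M: "0 < M" and ref: "refutation (trm_code s) (trm_code t) M S T"
    unfolding refutable_def by blast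
  let ?R = "\<lambda>u x y. prod_encode (u, prod_encode (x, y)) \<in> set_decode S"
  let ?T = "\<lambda>u. u \<in> set_decode T"
  define \<sigma> where "\<sigma> i = extend_warp M (?R (prod_encode (0, i))) (?T (prod_encode (0, i)))" for i
  have cert: "certificate (trm_code s + trm_code t) M ?R ?T" using ref by (simp add: refutation_def)
  obtain x y z where le: "x \<le> M" "y \<le> M" "z \<le> M"
    and R: "?R (trm_code s) x y" "?R (trm_code t) x z" and "y \<noteq> z"
    using ref unfolding refutation_def by blast
  have "tw_eval \<sigma> s (value_of M x) = value_of M y" "tw_eval \<sigma> t (value_of M x) = value_of M z"
    using certificate_sound[OF cert M, of s] certificate_sound[OF cert M, of t] R le
    unfolding \<sigma>_def by simp_all
  then have "tw_eval \<sigma> s \<noteq> tw_eval \<sigma> t" using \<open>y \<noteq> z\<close> le by (metis value_of_eq_iff)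
  moreover have "\<forall>i. \<sigma> i \<in> time_warps" by (simp add: \<sigma>_def extend_warp_time_warp)
  ultimately show "\<not> W_models s t" unfolding W_models_def by blast
next
  assume "\<not> W_models s t"
  then obtain \<sigma> x0 where \<sigma>: "\<And>i. \<sigma> i \<in> time_warps" and neq: "tw_eval \<sigma> s x0 \<noteq> tw_eval \<sigma> t x0"
    unfolding W_models_def by blast
  let ?K = "trm_code s + trm_code t"
  let ?M = "4 ^ (?K + 3) :: nat"
  let ?B = "prod_encode (?K, prod_encode (?M, ?M))"
  obtain R T where cert: "certificate ?K ?M R T"
    and R: "\<And>c x y. R c x y \<Longrightarrow> c \<le> ?K \<and> x \<le> ?M \<and> y \<le> ?M" and T: "\<And>c. T c \<Longrightarrow> c \<le> ?K"
    and ex: "\<exists>x\<le>?M. \<exists>y\<le>?M. \<exists>z\<le>?M. R (trm_code s) x y \<and> R (trm_code t) x z \<and> y \<noteq> z"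
    using certificate_complete[OF \<sigma> neq] by blast
  define A where "A = {prod_encode (c, prod_encode (x, y)) | c x y. R c x y}"
  define B where "B = {c. T c}"
  have A: "A \<subseteq> {..?B}" unfolding A_def using R by (auto intro!: prod_encode_mono)
  have B: "B \<subseteq> {..?B}" unfolding B_def using T le_prod_encode_add[of ?K "prod_encode (?M, ?M)"] by fastforce
  have fin: "finite A" "finite B" using A B finite_subset by blast+
  \<comment> \<open>Both sets are finite, so decoding their codes recovers \<open>R\<close> and
    \<open>T\<close> exactly.\<close>
  have mem: "(\<lambda>u x y. prod_encode (u, prod_encode (x, y)) \<in> set_decode (set_encode A)) = R"
    "(\<lambda>u. u \<in> set_decode (set_encode B)) = T"
    using fin by (auto simp: A_def B_def fun_eq_iff)
  have "refutation (trm_code s) (trm_code t) ?M (set_encode A) (set_encode B)"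
    unfolding refutation_def mem using cert ex fun_cong[OF fun_cong[OF fun_cong[OF mem(1)]]] by simp
  moreover have "0 < ?M" by simp
  ultimately show "refutable (trm_code s) (trm_code t)"
    unfolding refutable_def using set_encode_le[OF A] set_encode_le[OF B] by blast
qed

text \<open>After unfolding, only arithmetic terms, comparisons, membership in decoded sets,
  connectives and bounded quantifiers remain, so the closure rules apply along the syntax.\<close>

lemma decidable_refutable: "decidable 2 (\<lambda>e. refutable (e 0) (e 1))"
  unfolding refutable_def refutation_def certificate_def var_ok_def one_ok_def inv_ok_def
    meet_ok_def join_ok_def dot_ok_def
  by (intro computable_intros) simp_all

theorem theorem3p12:
  shows "\<exists>r. \<forall>s t. rec_eval r [trm_code s, trm_code t] (if W_models s t then 1 else 0)"
proof -
  obtain r where r: "\<And>e. rec_eval r (map e [0..<2]) (if \<not> refutable (e 0) (e 1) then 1 else 0)"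
    using decidable_not[OF decidable_refutable] unfolding decidable_def computable_def by blast
  have "rec_eval r [trm_code s, trm_code t] (if W_models s t then 1 else 0)" for s t
    \<comment> \<open>The first two entries of this environment form the argument list
      \<open>[trm_code s, trm_code t]\<close>.\<close>
    using r[of "\<lambda>i. if i = 0 then trm_code s else trm_code t"]
    by (simp add: refutable_iff numeral_2_eq_2)
  then show ?thesis by blast
qed

end
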